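(* Let $(b,\mathcal{D},\mathcal{C})$ be a canonical Hadamard triple. Then there are infinitely many primitively non spectral integer eigenvalues $t\in\mathbb{N}$ of the canonical spectral pair $(\mu_{b,\mathcal{D}},\Lambda(b,\mathcal{C}))$.
   Context: $\mathbb{N}=\{1,2,\ldots\}$. For an integer $b>2$ and finite sets $\mathcal{D},\mathcal{C}\subset\mathbb{Z}$ with $\#\mathcal{D}=\#\mathcal{C}$ and $0\in\mathcal{C}$, $(b,\mathcal{D},\mathcal{C})$ is an integral Hadamard triple if the matrix $\frac{1}{\sqrt{\#\mathcal{D}}}\left[e^{-2\pi i cd/b}\right]_{d\in\mathcal{D},c\in\mathcal{C}}$ is unitary. It is a canonical Hadamard triple if moreover $b>\#\mathcal{D}$, $0\in\mathcal{D}$, $\gcd(\mathcal{D})=1$ and $0\in\mathcal{C}\subset\{0,1,\ldots,b-2\}$. $\mu_{b,\mathcal{D}}$ is the unique Borel probability measure on $\mathbb{R}$ with $\mu_{b,\mathcal{D}}(E)=\frac{1}{\#\mathcal{D}}\sum_{d\in\mathcal{D}}\mu_{b,\mathcal{D}}(\phi_d^{-1}(E))$ for all Borel $E$, where $\phi_d(x)=\frac{1}{b}(x+d)$. $\Lambda(b,\mathcal{C})=\bigcup_{k=1}^\infty(\mathcal{C}+b\mathcal{C}+\cdots+b^{k-1}\mathcal{C})$. A countable set $\Lambda\subset\mathbb{R}$ is a spectrum of $\mu$ (and $(\mu,\Lambda)$ is a spectral pair) if $\{e^{-2\pi i\lambda x}:\lambda\in\Lambda\}$ is an orthonormal basis of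 $L^2(\mu)$. For a canonical Hadamard triple, $(\mu_{b,\mathcal{D}},\Lambda(b,\mathcal{C}))$ is called the canonical spectral pair. $t\in\mathbb{N}$ is a spectral (integer) eigenvalue of $(\mu_{b,\mathcal{D}},\Lambda(b,\mathcal{C}))$ if $t\Lambda(b,\mathcal{C})$ is a spectrum of $\mu_{b,\mathcal{D}}$. $t$ is a primitively non spectral integer eigenvalue if $t$ is not a spectral eigenvalue and every proper factor $t'$ of $t$ ($t'\in\mathbb{N}$, $t'\mid t$, $t'\ne t$) is a spectral eigenvalue. *)

theory Defs
  imports "HOL-Probability.Probability"
begin

section \<open>Hadamard triples\<close>

text \<open>Matrices with rows indexed by \<open>I\<close> and columns indexed by \<open>J\<close>; the entries outside
  \<open>I \<times> J\<close> are ignored.\<close>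

definition unitary_matrix_on :: "'a set \<Rightarrow> 'b set \<Rightarrow> ('a \<Rightarrow> 'b \<Rightarrow> complex) \<Rightarrow> bool" where
  "unitary_matrix_on I J U \<longleftrightarrow>
     finite I \<and> finite J \<and> card I = card J \<and>
     (\<forall>i\<in>I. \<forall>i'\<in>I. (\<Sum>j\<in>J. U i j * cnj (U i' j)) = (if i = i' then 1 else 0)) \<and>
     (\<forall>j\<in>J. \<forall>j'\<in>J. (\<Sum>i\<in>I. cnj (U i j) * U i j') = (if j = j' then 1 else 0))"

definition integral_hadamard_triple :: "int \<Rightarrow> int set \<Rightarrow> int set \<Rightarrow> bool" where
  "integral_hadamard_triple b D C \<longleftrightarrow>
     b > 2 \<and> finite D \<and> finite C \<and> card D = card C \<and> 0 \<in> C \<and>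
     unitary_matrix_on D C
       (\<lambda>d c. 1 / of_real (sqrt (of_nat (card D))) *
              exp (- (2 * of_real pi * \<i> * of_int c * of_int d / of_int b)))"

definition canonical_hadamard_triple :: "int \<Rightarrow> int set \<Rightarrow> int set \<Rightarrow> bool" where
  "canonical_hadamard_triple b D C \<longleftrightarrow>
     integral_hadamard_triple b D C \<and>
     b > int (card D) \<and> 0 \<in> D \<and> Gcd D = 1 \<and> 0 \<in> C \<and> C \<subseteq> {0..b - 2}"


section \<open>The self-similar measure\<close>

definition ifs_map :: "int \<Rightarrow> int \<Rightarrow> real \<Rightarrow> real" where
  "ifs_map b d x = 1 / real_of_int b * (x + real_of_int d)"

definition is_self_similar :: "int \<Rightarrow> int set \<Rightarrow> real measure \<Rightarrow> bool" where
  "is_self_similar b D M \<longleftrightarrow>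
     prob_space M \<and> sets M = sets borel \<and>
     (\<forall>E\<in>sets borel. measure M E =
        1 / real (card D) * (\<Sum>d\<in>D. measure M (ifs_map b d -` E)))"

definition self_similar_measure :: "int \<Rightarrow> int set \<Rightarrow> real measure" where
  "self_similar_measure b D = (THE M. is_self_similar b D M)"

text \<open>Existence and uniqueness of the self-similar measure, so that the definite description
  in \<open>self_similar_measure\<close> denotes.\<close>

lemma emeasure_self_similar:
  assumes "finite D" "D \<noteq> {}" "is_self_similar b D M" "E \<in> sets borel"
  shows "emeasure M E = (\<integral>\<^sup>+d. emeasure M (ifs_map b d -` E) \<partial>measure_pmf (pmf_of_set D))"
proof -
  from assms interpret prob_space M by (simp add: is_self_similar_def)
  have "emeasure M E = ennreal (1 / real (card D) * (\<Sum>d\<in>D. measure M (ifs_map b d -` E)))"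
    using assms by (simp add: is_self_similar_def emeasure_eq_measure)
  also have "\<dots> = (\<Sum>d\<in>D. emeasure M (ifs_map b d -` E)) / of_nat (card D)"
    using assms by (simp add: emeasure_eq_measure sum_ennreal divide_ennreal[symmetric]
        card_gt_0_iff sum_nonneg ennreal_of_nat_eq_real_of_nat)
  finally show ?thesis
    using assms by (simp add: nn_integral_pmf_of_set)
qed

lemma self_similar_eq_distr:
  assumes "finite D" "D \<noteq> {}" "is_self_similar b D M"
  shows "M = distr (measure_pmf (pmf_of_set D) \<Otimes>\<^sub>M M) borel (\<lambda>(d, x). ifs_map b d x)"
proof (rule measure_eqI)
  have sM[measurable_cong]: "sets M = sets borel" using assms by (simp add: is_self_similar_def)
  from assms interpret M: prob_space M by (simp add: is_self_similar_def)
  interpret pair_prob_space "measure_pmf (pmf_of_set D)" M ..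
  have [measurable]: "(\<lambda>(d, x). ifs_map b d x) \<in> borel_measurable (measure_pmf (pmf_of_set D) \<Otimes>\<^sub>M M)"
    unfolding ifs_map_def by measurable
  show "sets M = sets (distr (measure_pmf (pmf_of_set D) \<Otimes>\<^sub>M M) borel (\<lambda>(d, x). ifs_map b d x))"
    using sM by simp
  fix E assume "E \<in> sets M"
  then have E[measurable]: "E \<in> sets borel" using sM by simp
  have spM: "space M = UNIV" using sets_eq_imp_space_eq[OF sM] by simp
  have "emeasure (distr (measure_pmf (pmf_of_set D) \<Otimes>\<^sub>M M) borel (\<lambda>(d, x). ifs_map b d x)) E
     = (\<integral>\<^sup>+d. emeasure M (Pair d -` ((\<lambda>(d, x). ifs_map b d x) -` E \<inter>
            space (measure_pmf (pmf_of_set D) \<Otimes>\<^sub>M M))) \<partial>measure_pmf (pmf_of_set D))"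
    by (subst emeasure_distr, measurable) (rule M.emeasure_pair_measure_alt, measurable)
  also have "\<dots> = (\<integral>\<^sup>+d. emeasure M (ifs_map b d -` E) \<partial>measure_pmf (pmf_of_set D))"
    by (intro nn_integral_cong arg_cong2[where f=emeasure])
       (auto simp: space_pair_measure spM)
  finally show "emeasure M E =
      emeasure (distr (measure_pmf (pmf_of_set D) \<Otimes>\<^sub>M M) borel (\<lambda>(d, x). ifs_map b d x)) E"
    using emeasure_self_similar[OF assms E] by simp
qed

lemma char_self_similar:
  assumes "finite D" "D \<noteq> {}" "is_self_similar b D M"
  shows "char M t = (\<Sum>d\<in>D. iexp (t / real_of_int b * real_of_int d)) / of_nat (card D)
                    * char M (t / real_of_int b)"
proof -
  have sM[measurable_cong]: "sets M = sets borel" using assms by (simp add: is_self_similar_def)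
  from assms interpret M: prob_space M by (simp add: is_self_similar_def)
  interpret pair_prob_space "measure_pmf (pmf_of_set D)" M ..
  have m[measurable]: "(\<lambda>(d, x). ifs_map b d x) \<in> borel_measurable (measure_pmf (pmf_of_set D) \<Otimes>\<^sub>M M)"
    unfolding ifs_map_def by measurable
  have m2: "(\<lambda>(d, x). iexp (t * ifs_map b d x)) \<in> borel_measurable (measure_pmf (pmf_of_set D) \<Otimes>\<^sub>M M)"
    unfolding ifs_map_def by measurable
  have "char M t = char (distr (measure_pmf (pmf_of_set D) \<Otimes>\<^sub>M M) borel (\<lambda>(d, x). ifs_map b d x)) t"
    using self_similar_eq_distr[OF assms] by simp
  also have "\<dots> = (CLINT y|(measure_pmf (pmf_of_set D) \<Otimes>\<^sub>M M). (case y of (d, x) \<Rightarrow> iexp (t * ifs_map b d x)))"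
    unfolding char_def by (subst integral_distr) (auto intro!: m Bochner_Integration.integral_cong)
  also have "\<dots> = (CLINT d|measure_pmf (pmf_of_set D). CLINT x|M. iexp (t * ifs_map b d x))"
    by (subst integral_fst'[symmetric])
       (auto intro!: finite_measure.integrable_const_bound[where B=1] m2 P.finite_measure_axioms)
  also have "\<dots> = (\<Sum>d\<in>D. CLINT x|M. iexp (t * ifs_map b d x)) / of_nat (card D)"
    using assms by (subst integral_measure_pmf[of D])
      (simp_all add: sum_distrib_left scaleR_conv_of_real divide_inverse mult.commute del: of_real_mult)
  also have "(\<Sum>d\<in>D. CLINT x|M. iexp (t * ifs_map b d x)) =
     (\<Sum>d\<in>D. iexp (t / real_of_int b * real_of_int d) * char M (t / real_of_int b))"
  proof (rule sum.cong)
    fix d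
    have "iexp (t * ifs_map b d x) = iexp (t / real_of_int b * real_of_int d) * iexp (t / real_of_int b * x)" for x
      by (subst exp_add[symmetric], rule arg_cong[where f=exp])
         (simp add: ifs_map_def algebra_simps add_divide_distrib)
    then show "(CLINT x|M. iexp (t * ifs_map b d x)) = iexp (t / real_of_int b * real_of_int d) * char M (t / real_of_int b)"
      by (simp only: char_def integral_mult_right_zero)
  qed simp
  finally show ?thesis by (simp only: sum_distrib_right times_divide_eq_left)
qed

lemma self_similar_unique:
  assumes D: "finite D" "D \<noteq> {}" and b: "b > 1"
    and M: "is_self_similar b D M" and N: "is_self_similar b D N"
  shows "M = N"
proof -
  interpret M: real_distribution M
    using M by (auto simp: is_self_similar_def real_distribution_def real_distribution_axioms_def)
  interpret N: real_distribution N
    using N by (auto simp: is_self_similar_def real_distribution_def real_distribution_axioms_def)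
  define p where "p t = (\<Sum>d\<in>D. iexp (t * real_of_int d)) / of_nat (card D)" for t
  define \<delta> where "\<delta> t = norm (char M t - char N t)" for t
  have p: "norm (p t) \<le> 1" for t
  proof -
    have "norm (\<Sum>d\<in>D. iexp (t * real_of_int d)) \<le> (\<Sum>d\<in>D. norm (iexp (t * real_of_int d)))"
      by (rule norm_sum)
    also have "\<dots> = real (card D)" by (simp del: of_real_mult)
    finally show ?thesis using D by (simp add: p_def norm_divide divide_le_eq card_gt_0_iff)
  qed
  have step: "\<delta> t \<le> \<delta> (t / b)" for t
  proof -
    have "char M t = p (t / b) * char M (t / b)" "char N t = p (t / b) * char N (t / b)"
      unfolding p_def by (rule char_self_similar[OF D M] char_self_similar[OF D N])+
    then have "char M t - char N t = p (t / b) * (char M (t / b) - char N (t / b))"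
      by (simp only: right_diff_distrib)
    then show ?thesis
      using mult_right_mono[OF p[of "t / b"], of "\<delta> (t / b)"]
      by (simp add: \<delta>_def norm_mult)
  qed
  have iter: "\<delta> t \<le> \<delta> (t / real_of_int b ^ n)" for t n
  proof (induction n)
    case (Suc n)
    then show ?case using step[of "t / real_of_int b ^ n"] by (simp add: mult.commute)
  qed simp
  have "\<delta> t \<le> 0" for t
  proof (rule LIMSEQ_le_const)
    have "(\<lambda>n. t * inverse (real_of_int b) ^ n) \<longlonglongrightarrow> t * 0"
      using b by (intro tendsto_intros LIMSEQ_power_zero) (simp add: inverse_less_1_iff)
    then have lim: "(\<lambda>n. t / real_of_int b ^ n) \<longlonglongrightarrow> 0"
      by (simp add: power_inverse divide_inverse)
    have "isCont \<delta> 0"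
      unfolding \<delta>_def by (intro continuous_intros M.isCont_char N.isCont_char)
    from isCont_tendsto_compose[OF this lim]
    show "(\<lambda>n. \<delta> (t / real_of_int b ^ n)) \<longlonglongrightarrow> 0"
      by (simp add: \<delta>_def M.char_zero N.char_zero)
  qed (use iter in auto)
  then have "char M = char N"
    by (intro ext) (simp add: \<delta>_def)
  then show ?thesis
    by (rule Levy_uniqueness[OF M.real_distribution_axioms N.real_distribution_axioms])
qed

lemma self_similar_exists:
  assumes D: "finite D" "D \<noteq> {}" and b: "b > 1"
  shows "\<exists>M. is_self_similar b D M"
proof -
  define P where "P = measure_pmf (pmf_of_set D)"
  interpret P: prob_space P unfolding P_def by (rule measure_pmf.prob_space_axioms)
  define S where "S = stream_space P"
  interpret S: prob_space S unfolding S_def by (rule P.prob_space_stream_space)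
  have spS: "space S = UNIV" by (simp add: S_def P_def space_stream_space)
  obtain d0 where d0: "d0 \<in> D" using D by auto
  define g where "g d = real_of_int (if d \<in> D then d else d0)" for d
  define X where "X \<omega> = (\<Sum>n. g (\<omega> !! n) * (1 / real_of_int b) ^ Suc n)" for \<omega>
  have summ: "summable (\<lambda>n. g (\<omega> !! n) * (1 / real_of_int b) ^ Suc n)" for \<omega>
  proof (rule summable_comparison_test')
    show "summable (\<lambda>n. (\<Sum>d\<in>D. \<bar>real_of_int d\<bar>) * (1 / real_of_int b) ^ Suc n)"
      using b by (intro summable_mult summable_Suc_iff[THEN iffD2] summable_geometric) simp
    fix n :: nat assume "n \<ge> 0"
    have "\<bar>g d\<bar> \<le> (\<Sum>d\<in>D. \<bar>real_of_int d\<bar>)" for d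
      unfolding g_def using D d0 by (auto intro!: member_le_sum[where f="\<lambda>d. \<bar>real_of_int d\<bar>"])
    then show "norm (g (\<omega> !! n) * (1 / real_of_int b) ^ Suc n) \<le> (\<Sum>d\<in>D. \<bar>real_of_int d\<bar>) * (1 / real_of_int b) ^ Suc n"
      using b by (auto simp only: real_norm_def abs_mult power_abs intro!: mult_mono) auto
  qed
  have [measurable]: "g \<in> borel_measurable P" by (simp add: P_def)
  have [measurable]: "X \<in> borel_measurable S"
    unfolding X_def S_def by measurable
  have X_Cons: "X (d ## \<omega>) = ifs_map b d (X \<omega>)" if "d \<in> D" for d \<omega>
  proof -
    have "X (d ## \<omega>) = (\<Sum>n. g (\<omega> !! n) * (1 / real_of_int b) ^ Suc (Suc n)) + g d * (1 / real_of_int b)"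
      unfolding X_def using suminf_split_head[OF summ[of "d ## \<omega>"]] by simp
    also have "(\<Sum>n. g (\<omega> !! n) * (1 / real_of_int b) ^ Suc (Suc n)) = (1 / real_of_int b) * X \<omega>"
      unfolding X_def by (subst suminf_mult[OF summ, symmetric]) (simp add: mult_ac)
    finally show ?thesis using that by (simp add: ifs_map_def g_def algebra_simps add_divide_distrib)
  qed
  define M where "M = distr S borel X"
  have "is_self_similar b D M"
    unfolding is_self_similar_def
  proof (intro conjI ballI)
    show pM: "prob_space M" unfolding M_def by (rule S.prob_space_distr) measurable
    interpret M: prob_space M by (rule pM)
    show "sets M = sets borel" by (simp add: M_def)
    fix E :: "real set" assume E[measurable]: "E \<in> sets borel"
    have [measurable]: "ifs_map b d -` E \<in> sets borel" for d
    proof -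
      have "ifs_map b d \<in> borel_measurable borel" unfolding ifs_map_def by measurable
      from measurable_sets[OF this E] show ?thesis by simp
    qed
    have "emeasure M E = emeasure S (X -` E \<inter> space S)"
      unfolding M_def by (rule emeasure_distr) measurable
    also have "\<dots> = (\<integral>\<^sup>+d. emeasure S {\<omega>\<in>space S. d ## \<omega> \<in> X -` E \<inter> space S} \<partial>P)"
      unfolding S_def by (rule P.emeasure_stream_space) (fold S_def, measurable)
    also have "\<dots> = (\<Sum>d\<in>D. emeasure S {\<omega>\<in>space S. d ## \<omega> \<in> X -` E \<inter> space S}) / of_nat (card D)"
      unfolding P_def using D by (simp add: nn_integral_pmf_of_set)
    also have "(\<Sum>d\<in>D. emeasure S {\<omega>\<in>space S. d ## \<omega> \<in> X -` E \<inter> space S}) =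
               (\<Sum>d\<in>D. emeasure M (ifs_map b d -` E))"
    proof (rule sum.cong)
      fix d assume "d \<in> D"
      have "emeasure M (ifs_map b d -` E) = emeasure S (X -` (ifs_map b d -` E) \<inter> space S)"
        unfolding M_def by (rule emeasure_distr) measurable
      also have "X -` (ifs_map b d -` E) \<inter> space S = {\<omega>\<in>space S. d ## \<omega> \<in> X -` E \<inter> space S}"
        using X_Cons[OF \<open>d \<in> D\<close>] by (auto simp: spS)
      finally show "emeasure S {\<omega>\<in>space S. d ## \<omega> \<in> X -` E \<inter> space S} = emeasure M (ifs_map b d -` E)" ..
    qed simp
    finally have "ennreal (measure M E) = ennreal (1 / real (card D) * (\<Sum>d\<in>D. measure M (ifs_map b d -` E)))"
      using D by (simp add: M.emeasure_eq_measure sum_ennreal divide_ennreal[symmetric]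
        card_gt_0_iff sum_nonneg ennreal_of_nat_eq_real_of_nat)
    then show "measure M E = 1 / real (card D) * (\<Sum>d\<in>D. measure M (ifs_map b d -` E))"
      by (subst (asm) ennreal_inj) (auto simp: sum_nonneg)
  qed
  then show ?thesis by blast
qed

lemma is_self_similar_self_similar_measure:
  assumes "finite D" "D \<noteq> {}" "b > 1"
  shows "is_self_similar b D (self_similar_measure b D)"
proof -
  obtain M where "is_self_similar b D M"
    using self_similar_exists[OF assms] by blast
  then show ?thesis
    unfolding self_similar_measure_def by (rule theI) (rule self_similar_unique[OF assms _ \<open>is_self_similar b D M\<close>])
qed

lemma self_similar_measure_eqI:
  assumes "finite D" "D \<noteq> {}" "b > 1" "is_self_similar b D M"
  shows "self_similar_measure b D = M"
  using self_similar_unique[OF assms(1-3) is_self_similar_self_similar_measure[OF assms(1-3)] assms(4)] .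


section \<open>Spectra\<close>

text \<open>Elements of \<open>L\<^sup>2(M)\<close> are represented by functions, so equality of classes is equality
  almost everywhere.\<close>

definition L2_space :: "'a measure \<Rightarrow> ('a \<Rightarrow> complex) set" where
  "L2_space M = {f \<in> borel_measurable M. integrable M (\<lambda>x. (cmod (f x))\<^sup>2)}"

definition L2_inner :: "'a measure \<Rightarrow> ('a \<Rightarrow> complex) \<Rightarrow> ('a \<Rightarrow> complex) \<Rightarrow> complex" where
  "L2_inner M f g = (LINT x|M. f x * cnj (g x))"

definition L2_norm :: "'a measure \<Rightarrow> ('a \<Rightarrow> complex) \<Rightarrow> real" where
  "L2_norm M f = sqrt (LINT x|M. (cmod (f x))\<^sup>2)"

text \<open>Basis is meant in the Hilbert space sense: finite linear combinations are dense.\<close>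

definition L2_orthonormal_basis :: "'a measure \<Rightarrow> 'i set \<Rightarrow> ('i \<Rightarrow> 'a \<Rightarrow> complex) \<Rightarrow> bool" where
  "L2_orthonormal_basis M I e \<longleftrightarrow>
     (\<forall>i\<in>I. e i \<in> L2_space M) \<and>
     (\<forall>i\<in>I. \<forall>j\<in>I. L2_inner M (e i) (e j) = (if i = j then 1 else 0)) \<and>
     (\<forall>f\<in>L2_space M. \<forall>\<epsilon>>0. \<exists>F a. finite F \<and> F \<subseteq> I \<and>
        L2_norm M (\<lambda>x. f x - (\<Sum>i\<in>F. a i * e i x)) < \<epsilon>)"

definition is_spectrum :: "real measure \<Rightarrow> real set \<Rightarrow> bool" where
  "is_spectrum M \<Lambda> \<longleftrightarrow>
     countable \<Lambda> \<and>
     L2_orthonormal_basis M \<Lambda>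
       (\<lambda>l x. exp (- (2 * of_real pi * \<i> * of_real l * of_real x)))"

definition canonical_spectrum :: "int \<Rightarrow> int set \<Rightarrow> int set" where
  "canonical_spectrum b C =
     (\<Union>k\<in>{1..}. {(\<Sum>j<k. b ^ j * c j) | c :: nat \<Rightarrow> int. \<forall>j<k. c j \<in> C})"

definition spectral_eigenvalue :: "int \<Rightarrow> int set \<Rightarrow> int set \<Rightarrow> nat \<Rightarrow> bool" where
  "spectral_eigenvalue b D C t \<longleftrightarrow>
     t \<ge> 1 \<and>
     is_spectrum (self_similar_measure b D)
       ((\<lambda>l. real t * real_of_int l) ` canonical_spectrum b C)"

definition primitively_nonspectral_eigenvalue :: "int \<Rightarrow> int set \<Rightarrow> int set \<Rightarrow> nat \<Rightarrow> bool" where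
  "primitively_nonspectral_eigenvalue b D C t \<longleftrightarrow>
     t \<ge> 1 \<and> \<not> spectral_eigenvalue b D C t \<and>
     (\<forall>t'. t' \<ge> 1 \<and> t' dvd t \<and> t' \<noteq> t \<longrightarrow> spectral_eigenvalue b D C t')"

end

(* The value t = 1 is spectral: the function q (y) = sum over l in the spectrum of |ft (y + l)|^2
   satisfies q (x) = sum over c of |mask ((x + c) / b)|^2 q ((x + c) / b), where the weights add up
   to 1, and is lower semicontinuous. If its minimum near the attractor of x -> (x + c) / b were less
   than 1, the minimum set would be a finite set of points where |mask| = 1, that is, of integers; but
   the only integer there is 0, and q (0) = 1. So every character lies in the closed span of the
   canonical family, and characters span a dense subspace.

   For n >= b - 1 the repunit t = 1 + b + ... + b^(n-1) is not spectral, since an integer character is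
   orthogonal to the whole family t * Lambda. Repunits of distinct prime lengths are coprime, so their
   minimal non-spectral divisors, none of which is 1, are pairwise distinct. *)

theory Submission
  imports Defs "HOL-Complex_Analysis.Complex_Analysis"
begin

section \<open>Closed subspaces of square-integrable functions\<close>

text \<open>The digit bound \<open>b - 2\<close> decides the case t = 1: the attractor of the maps x
  -> (x + c) / b lies in \<open>[0, top_pt]\<close> with \<open>top_pt < 1\<close>, so 0 is the only
  integer near it. A digit \<open>b - 1\<close> would add the fixed point 1, about which
  \<open>q 0 = 1\<close> says nothing. Repunits are chosen for two properties. They are 1 modulo b,
  so multiplication by t keeps the lowest digit of a difference, and t * Lambda stays orthogonal;
  what fails is completeness. Moreover (b - 1) * t = b^n - 1, so the geometric series in b^n that
  comes from repeating a block of n digits can sum b-adically to an integer, which serves as the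
  missing frequency. One lemma, \<open>ft_zero\<close>, covers the orthogonality of the canonical
  family and that of the extra character. The primitive divisors themselves are never
  computed.\<close>

lemma L2_norm_less_iff:
  assumes "\<epsilon> > 0"
  shows "L2_norm M f < \<epsilon> \<longleftrightarrow> (LINT x|M. (cmod (f x))\<^sup>2) < \<epsilon>\<^sup>2"
  unfolding L2_norm_def using assms
  by (metis abs_of_pos real_sqrt_abs real_sqrt_less_iff)

lemma cmod_add_square_le: "(cmod (a + b))\<^sup>2 \<le> 2 * (cmod a)\<^sup>2 + 2 * (cmod b)\<^sup>2"
proof -
  have "(cmod (a + b))\<^sup>2 \<le> (cmod a + cmod b)\<^sup>2"
    by (simp add: norm_triangle_ineq power_mono)
  also have "\<dots> \<le> 2 * (cmod a)\<^sup>2 + 2 * (cmod b)\<^sup>2"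
    using zero_le_power2[of "cmod a - cmod b"] by (simp add: power2_eq_square algebra_simps)
  finally show ?thesis .
qed

lemma L2_space_add:
  assumes "f \<in> L2_space M" "g \<in> L2_space M"
  shows "(\<lambda>x. f x + g x) \<in> L2_space M"
proof -
  have [measurable]: "f \<in> borel_measurable M" "g \<in> borel_measurable M"
    using assms by (auto simp: L2_space_def)
  have "integrable M (\<lambda>x. (cmod (f x + g x))\<^sup>2)"
  proof (rule Bochner_Integration.integrable_bound)
    show "integrable M (\<lambda>x. 2 * (cmod (f x))\<^sup>2 + 2 * (cmod (g x))\<^sup>2)"
      using assms by (auto simp: L2_space_def)
    show "AE x in M. norm ((cmod (f x + g x))\<^sup>2) \<le> norm (2 * (cmod (f x))\<^sup>2 + 2 * (cmod (g x))\<^sup>2)"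
      using cmod_add_square_le by (intro AE_I2) (auto simp: abs_of_nonneg)
  qed measurable
  then show ?thesis by (simp add: L2_space_def)
qed

lemma L2_space_cmult:
  assumes "f \<in> L2_space M"
  shows "(\<lambda>x. c * f x) \<in> L2_space M"
  using assms by (auto simp: L2_space_def norm_mult power_mult_distrib)

lemma L2_space_diff:
  assumes "f \<in> L2_space M" "g \<in> L2_space M"
  shows "(\<lambda>x. f x - g x) \<in> L2_space M"
  using L2_space_add[OF assms(1) L2_space_cmult[OF assms(2), of "-1"]] by simp

lemma (in finite_measure) L2_space_bounded:
  assumes "f \<in> borel_measurable M" "\<And>x. x \<in> space M \<Longrightarrow> cmod (f x) \<le> B"
  shows "f \<in> L2_space M"
proof -
  note assms(1)[measurable]
  have "integrable M (\<lambda>x. (cmod (f x))\<^sup>2)"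
    by (rule integrable_const_bound[where B="B\<^sup>2"]) (auto intro!: AE_I2 power_mono assms)
  then show ?thesis using assms by (simp add: L2_space_def)
qed

text \<open>A substitute for the triangle inequality that stays with squared norms; the factor 2 is
  harmless for limits.\<close>

lemma L2_dist_square_le:
  assumes "f \<in> L2_space M" "g \<in> L2_space M" "h \<in> L2_space M"
  shows "(LINT x|M. (cmod (f x - h x))\<^sup>2) \<le>
    2 * (LINT x|M. (cmod (f x - g x))\<^sup>2) + 2 * (LINT x|M. (cmod (g x - h x))\<^sup>2)"
proof -
  have i: "integrable M (\<lambda>x. (cmod (f x - g x))\<^sup>2)" "integrable M (\<lambda>x. (cmod (g x - h x))\<^sup>2)"
    "integrable M (\<lambda>x. (cmod (f x - h x))\<^sup>2)"
    using L2_space_diff[of f M g] L2_space_diff[of g M h] L2_space_diff[of f M h] assms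
    by (auto simp: L2_space_def)
  have "(LINT x|M. (cmod (f x - h x))\<^sup>2) \<le>
    (LINT x|M. 2 * (cmod (f x - g x))\<^sup>2 + 2 * (cmod (g x - h x))\<^sup>2)"
    using i cmod_add_square_le[of "f x - g x" "g x - h x" for x]
    by (intro integral_mono) auto
  then show ?thesis using i by simp
qed

locale L2_subspace =
  fixes M :: "'a measure" and S :: "('a \<Rightarrow> complex) set"
  assumes sub: "S \<subseteq> L2_space M"
    and zero: "(\<lambda>x. 0) \<in> S"
    and add: "f \<in> S \<Longrightarrow> g \<in> S \<Longrightarrow> (\<lambda>x. f x + g x) \<in> S"
    and cmult: "f \<in> S \<Longrightarrow> (\<lambda>x. c * f x) \<in> S"
begin

text \<open>Closeness is measured by squared distances, so no square root appears until
  \<open>is_spectrum_iff\<close>.\<close>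

definition cl :: "('a \<Rightarrow> complex) set" where
  "cl = {f \<in> L2_space M. \<forall>\<epsilon>>0. \<exists>g\<in>S. (LINT x|M. (cmod (f x - g x))\<^sup>2) < \<epsilon>}"

lemma cl_L2: "f \<in> cl \<Longrightarrow> f \<in> L2_space M"
  by (simp add: cl_def)

lemma clD:
  assumes "f \<in> cl" "\<epsilon> > 0"
  obtains g where "g \<in> S" "g \<in> L2_space M" "(LINT x|M. (cmod (f x - g x))\<^sup>2) < \<epsilon>"
  using assms sub unfolding cl_def by blast

lemma cl_limit:
  assumes f: "f \<in> L2_space M" and F: "\<And>n. F n \<in> cl"
    and lim: "(\<lambda>n. LINT x|M. (cmod (f x - F n x))\<^sup>2) \<longlonglongrightarrow> 0"
  shows "f \<in> cl"
  unfolding cl_def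
proof (intro CollectI conjI f allI impI)
  fix \<epsilon> :: real assume e: "\<epsilon> > 0"
  \<comment> \<open>The quarter compensates for the factor 2 in \<open>L2_dist_square_le\<close> on
    each of the two distances.\<close>
  from order_tendstoD(2)[OF lim, of "\<epsilon> / 4"] e
  obtain n where n: "(LINT x|M. (cmod (f x - F n x))\<^sup>2) < \<epsilon> / 4"
    by (auto simp: eventually_sequentially)
  obtain g where g: "g \<in> S" "g \<in> L2_space M" "(LINT x|M. (cmod (F n x - g x))\<^sup>2) < \<epsilon> / 4"
    using clD[OF F[of n], of "\<epsilon> / 4"] e by auto
  show "\<exists>g\<in>S. (LINT x|M. (cmod (f x - g x))\<^sup>2) < \<epsilon>"
    using g n L2_dist_square_le[OF f cl_L2[OF F[of n]] g(2)] by (intro bexI[of _ g]) auto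
qed

lemma cl_add:
  assumes "f \<in> cl" "g \<in> cl"
  shows "(\<lambda>x. f x + g x) \<in> cl"
  unfolding cl_def
proof (intro CollectI conjI L2_space_add cl_L2 assms allI impI)
  fix \<epsilon> :: real assume e: "\<epsilon> > 0"
  obtain f' where f': "f' \<in> S" "f' \<in> L2_space M" "(LINT x|M. (cmod (f x - f' x))\<^sup>2) < \<epsilon> / 4"
    using clD[OF assms(1), of "\<epsilon> / 4"] e by auto
  obtain g' where g': "g' \<in> S" "g' \<in> L2_space M" "(LINT x|M. (cmod (g x - g' x))\<^sup>2) < \<epsilon> / 4"
    using clD[OF assms(2), of "\<epsilon> / 4"] e by auto
  have "(LINT x|M. (cmod (f x + g x - (f' x + g' x)))\<^sup>2)
    \<le> 2 * (LINT x|M. (cmod (f x + g x - (f' x + g x)))\<^sup>2)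
      + 2 * (LINT x|M. (cmod (f' x + g x - (f' x + g' x)))\<^sup>2)"
    using assms f' g' by (intro L2_dist_square_le L2_space_add) (auto intro: cl_L2)
  then show "\<exists>h\<in>S. (LINT x|M. (cmod (f x + g x - h x))\<^sup>2) < \<epsilon>"
    using f' g' by (intro bexI[of _ "\<lambda>x. f' x + g' x"] add) auto
qed

lemma cl_cmult:
  assumes "f \<in> cl"
  shows "(\<lambda>x. c * f x) \<in> cl"
  unfolding cl_def
proof (intro CollectI conjI L2_space_cmult cl_L2 assms allI impI)
  fix \<epsilon> :: real assume e: "\<epsilon> > 0"
  show "\<exists>h\<in>S. (LINT x|M. (cmod (c * f x - h x))\<^sup>2) < \<epsilon>"
  proof (cases "c = 0")
    case True
    then show ?thesis using e zero by (intro bexI[of _ "\<lambda>x. 0"]) auto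
  next
    case False
    then obtain g where g: "g \<in> S" "(LINT x|M. (cmod (f x - g x))\<^sup>2) < \<epsilon> / (cmod c)\<^sup>2"
      using clD[OF assms, of "\<epsilon> / (cmod c)\<^sup>2"] e by auto
    have "(LINT x|M. (cmod (c * f x - c * g x))\<^sup>2) = (cmod c)\<^sup>2 * (LINT x|M. (cmod (f x - g x))\<^sup>2)"
      by (simp add: norm_mult power_mult_distrib flip: right_diff_distrib)
    then show ?thesis using g False
      by (intro bexI[of _ "\<lambda>x. c * g x"] cmult) (auto simp: field_simps)
  qed
qed

lemma cl_zero: "(\<lambda>x. 0) \<in> cl"
  using sub zero by (auto simp: cl_def intro!: bexI[of _ "\<lambda>x. 0"])

lemma cl_diff:
  assumes "f \<in> cl" "g \<in> cl"
  shows "(\<lambda>x. f x - g x) \<in> cl"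
  using cl_add[OF assms(1) cl_cmult[OF assms(2), of "-1"]] by simp

lemma cl_sum:
  assumes "\<And>i. i \<in> I \<Longrightarrow> f i \<in> cl"
  shows "(\<lambda>x. \<Sum>i\<in>I. f i x) \<in> cl"
  using assms by (induction I rule: infinite_finite_induct) (auto intro: cl_zero cl_add)

text \<open>The squared distances are dominated by (2 * w)^2, so pointwise limits under a
  square-integrable bound stay in the closure. All later approximations go through this.\<close>

lemma cl_dominated:
  assumes f[measurable]: "f \<in> borel_measurable M" and F: "\<And>n. F n \<in> cl"
    and lim: "\<And>x. x \<in> space M \<Longrightarrow> (\<lambda>n. F n x) \<longlonglongrightarrow> f x"
    and w: "integrable M (\<lambda>x. (w x)\<^sup>2)"
    and bd: "\<And>n x. x \<in> space M \<Longrightarrow> cmod (F n x) \<le> w x"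
  shows "f \<in> cl"
proof -
  have [measurable]: "F n \<in> borel_measurable M" for n
    using cl_L2[OF F[of n]] by (simp add: L2_space_def)
  have bdf: "cmod (f x) \<le> w x" if "x \<in> space M" for x
    using bd[OF that] by (intro LIMSEQ_le_const2[OF tendsto_norm[OF lim[OF that]]]) auto
  have w0: "0 \<le> w x" if "x \<in> space M" for x
    using bd[OF that, of 0] norm_ge_zero order_trans by blast
  have "integrable M (\<lambda>x. (cmod (f x))\<^sup>2)"
    by (rule Bochner_Integration.integrable_bound[OF w])
       (auto intro!: AE_I2 power_mono bdf)
  then have fL: "f \<in> L2_space M" by (simp add: L2_space_def)
  have "(\<lambda>n. LINT x|M. (cmod (f x - F n x))\<^sup>2) \<longlonglongrightarrow> (LINT x|M. 0)"
  proof (rule integral_dominated_convergence[where w="\<lambda>x. 4 * (w x)\<^sup>2"])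
    show "AE x in M. (\<lambda>n. (cmod (f x - F n x))\<^sup>2) \<longlonglongrightarrow> 0"
      by (intro AE_I2 tendsto_eq_intros lim) (auto intro: lim)
    fix n
    have "(cmod (f x - F n x))\<^sup>2 \<le> 4 * (w x)\<^sup>2" if "x \<in> space M" for x
    proof -
      have "(cmod (f x - F n x)) \<le> w x + w x"
        using bdf[OF that] bd[OF that, of n] norm_triangle_ineq4[of "f x" "F n x"] by linarith
      then have "(cmod (f x - F n x))\<^sup>2 \<le> (w x + w x)\<^sup>2" by (intro power_mono) auto
      then show ?thesis by (simp add: power2_eq_square)
    qed
    then show "AE x in M. norm ((cmod (f x - F n x))\<^sup>2) \<le> 4 * (w x)\<^sup>2"
      by (intro AE_I2) auto
  qed (use w in auto)
  then show ?thesis using cl_limit[OF fL F] by simp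
qed

end

section \<open>Density of trigonometric polynomials\<close>

definition chi :: "real \<Rightarrow> real \<Rightarrow> complex" where
  "chi l x = exp (- (2 * of_real pi * \<i> * of_real l * of_real x))"

lemma chi_cis: "chi l x = cis (- (2 * pi * l * x))"
  by (simp add: chi_def cis_conv_exp mult_ac)

lemma norm_chi [simp]: "cmod (chi l x) = 1"
  by (simp add: chi_cis)

lemma chi_add: "chi (l + k) x = chi l x * chi k x"
  by (simp add: chi_cis cis_mult algebra_simps)

lemma chi_0 [simp]: "chi 0 x = 1"
  by (simp add: chi_def)

lemma cnj_chi: "cnj (chi l x) = chi (- l) x"
  by (simp add: chi_cis cis_cnj)

lemma chi_measurable [measurable]: "chi l \<in> borel_measurable borel"
  unfolding chi_def by measurable

text \<open>Reduces completeness to a statement about single characters: from \<open>chi_cl\<close>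
  alone, for any finite Borel measure, the closure is shown to be all of the space.\<close>

locale L2_subspace_chi = L2_subspace M S + finite_measure M
  for M :: "real measure" and S +
  assumes sets_M: "sets M = sets borel"
    and chi_cl: "\<And>l. chi l \<in> cl"
begin

lemma space_M [simp]: "space M = UNIV"
  using sets_eq_imp_space_eq[OF sets_M] by simp

lemma borel_M [measurable_cong]: "sets M = sets borel" by (fact sets_M)

text \<open>Unlike \<open>cl\<close>, this class is visibly stable under multiplication by \<open>sin (s * (x - a))\<close>, hence by
  polynomials in it. Rescaled clipped sines then converge boundedly to indicators of half-lines.\<close>

definition mlt :: "(real \<Rightarrow> complex) set" where
  "mlt = {f. \<forall>l. (\<lambda>x. f x * chi l x) \<in> cl}"

lemma mlt_one: "(\<lambda>x. 1) \<in> mlt"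
  by (simp add: mlt_def chi_cl)

lemma mlt_cl: "f \<in> mlt \<Longrightarrow> f \<in> cl"
  unfolding mlt_def by (drule CollectD, drule spec[of _ 0]) simp

lemma mlt_cmult: "f \<in> mlt \<Longrightarrow> (\<lambda>x. c * f x) \<in> mlt"
  by (auto simp: mlt_def mult.assoc intro: cl_cmult)

lemma mlt_add: "f \<in> mlt \<Longrightarrow> g \<in> mlt \<Longrightarrow> (\<lambda>x. f x + g x) \<in> mlt"
  by (auto simp: mlt_def distrib_right intro: cl_add)

lemma mlt_chi: "f \<in> mlt \<Longrightarrow> (\<lambda>x. chi k x * f x) \<in> mlt"
  unfolding mlt_def
proof (intro CollectI allI)
  fix l assume "f \<in> {f. \<forall>l. (\<lambda>x. f x * chi l x) \<in> cl}"
  then have "(\<lambda>x. f x * chi (k + l) x) \<in> cl" by blast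
  then show "(\<lambda>x. chi k x * f x * chi l x) \<in> cl" by (simp add: chi_add mult_ac)
qed

lemma mlt_sin:
  assumes "f \<in> mlt"
  shows "(\<lambda>x. of_real (sin (s * (x - a))) * f x) \<in> mlt"
proof -
  \<comment> \<open>With this frequency \<open>chi k x\<close> is \<open>cis (- (s * x))\<close>,
    and \<open>u\<close> moves the phase origin to a; Euler's formula then writes the sine as a
    combination of two characters.\<close>
  define k where "k = s / (2 * pi)"
  define u where "u = cis (s * a)"
  have "of_real (sin (s * (x - a))) * f x =
    (\<i> / 2 * u) * (chi k x * f x) + (- \<i> / 2 * cnj u) * (chi (- k) x * f x)" for x
  proof -
    have k: "- (2 * pi * k * x) = - (s * x)" "- (2 * pi * (- k) * x) = s * x"
      by (simp_all add: k_def)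
    have "u * chi k x = cis (- (s * (x - a)))" "cnj u * chi (-k) x = cis (s * (x - a))"
      unfolding u_def chi_cis k cis_cnj cis_mult by (simp_all add: algebra_simps)
    have "(\<i> / 2 * u) * (chi k x * f x) + (- \<i> / 2 * cnj u) * (chi (- k) x * f x)
      = \<i> / 2 * (u * chi k x - cnj u * chi (- k) x) * f x"
      by (simp add: algebra_simps)
    also note \<open>u * chi k x = _\<close>
    also note \<open>cnj u * chi (- k) x = _\<close>
    also have "\<i> / 2 * (cis (- (s * (x - a))) - cis (s * (x - a))) = of_real (sin (s * (x - a)))"
      by (simp add: complex_eq_iff)
    finally show ?thesis ..
  qed
  then show ?thesis
    by (simp only: ) (intro mlt_add mlt_cmult mlt_chi assms)
qed

lemma mlt_polynomial_sin:
  assumes "real_polynomial_function p" "f \<in> mlt"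
  shows "(\<lambda>x. of_real (p (sin (s * (x - a)))) * f x) \<in> mlt"
  using assms
proof (induction arbitrary: f)
  case (linear p)
  interpret p: bounded_linear p by fact
  have p1: "p y = p 1 * y" for y :: real using p.scaleR[of y 1] by simp
  have "of_real (p (sin (s * (x - a)))) * f x = of_real (p 1) * (of_real (sin (s * (x - a))) * f x)"
    for x
    by (subst p1) simp
  then have "(\<lambda>x. of_real (p (sin (s * (x - a)))) * f x)
    = (\<lambda>x. of_real (p 1) * (of_real (sin (s * (x - a))) * f x))"
    by (rule ext)
  then show ?case using mlt_cmult[OF mlt_sin[OF linear(2)]] by (simp only:)
next
  case (const c)
  then show ?case by (rule mlt_cmult)
next
  case (add p q)
  show ?case
    using mlt_add[OF add.IH(1)[OF add.prems] add.IH(2)[OF add.prems]]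
    by (simp only: of_real_add distrib_right)
next
  case (mult p q)
  show ?case
    using mult.IH(1)[OF mult.IH(2)[OF mult.prems]] by (simp only: of_real_mult mult.assoc)
qed

text \<open>The sine takes values in [-1, 1], where Stone-Weierstrass gives uniform polynomial
  approximations of \<open>\<phi>\<close>; uniform closeness also supplies the constant bound
  \<open>B + 1\<close>.\<close>

lemma cl_continuous_sin:
  fixes \<phi> :: "real \<Rightarrow> real"
  assumes "continuous_on UNIV \<phi>"
  shows "(\<lambda>x. of_real (\<phi> (sin (s * (x - a))))) \<in> cl"
proof -
  have c: "continuous_on {-1..1} \<phi>" using assms continuous_on_subset by blast
  have "\<exists>p. real_polynomial_function p \<and> (\<forall>x\<in>{-1..1}. \<bar>\<phi> x - p x\<bar> < inverse (real (Suc n)))" for n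
  proof -
    have "0 < inverse (real (Suc n))" by simp
    then show ?thesis
    proof (rule Stone_Weierstrass_real_polynomial_function[OF compact_Icc c])
      fix p :: "real \<Rightarrow> real"
      assume "real_polynomial_function p"
        and "\<And>x. x \<in> {-1..1} \<Longrightarrow> \<bar>\<phi> x - p x\<bar> < inverse (real (Suc n))"
      then show ?thesis by (intro exI[of _ p]) simp
    qed
  qed
  then obtain p where p: "\<And>n. real_polynomial_function (p n)"
    "\<And>n x. x \<in> {-1..1} \<Longrightarrow> \<bar>\<phi> x - p n x\<bar> < inverse (real (Suc n))"
    by metis
  have lim: "(\<lambda>n. p n y) \<longlonglongrightarrow> \<phi> y" if "y \<in> {-1..1}" for y
  proof (rule LIM_zero_cancel, rule tendsto_rabs_zero_cancel)
    show "(\<lambda>n. \<bar>p n y - \<phi> y\<bar>) \<longlonglongrightarrow> 0"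
    proof (rule tendsto_sandwich[OF _ _ tendsto_const LIMSEQ_inverse_real_of_nat])
      have "\<bar>p n y - \<phi> y\<bar> \<le> inverse (real (Suc n))" for n
        using p(2)[OF that, of n] by (subst abs_minus_commute) (rule less_imp_le)
      then show "\<forall>\<^sub>F n in sequentially. \<bar>p n y - \<phi> y\<bar> \<le> inverse (real (Suc n))"
        by (intro always_eventually allI)
    qed simp
  qed
  have "\<exists>B. \<forall>x\<in>{-1..1}. \<bar>\<phi> x\<bar> \<le> B"
    using compact_imp_bounded[OF compact_continuous_image[OF c compact_Icc]]
    by (simp add: bounded_iff)
  then obtain B where B: "\<And>x. x \<in> {-1..1} \<Longrightarrow> \<bar>\<phi> x\<bar> \<le> B" by blast
  have [measurable]: "\<phi> \<in> borel_measurable borel"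
    using assms by (rule borel_measurable_continuous_onI)
  show ?thesis
  proof (rule cl_dominated)
    show "(\<lambda>x. of_real (p n (sin (s * (x - a))))) \<in> cl" for n
      using mlt_cl[OF mlt_polynomial_sin[OF p(1)[of n] mlt_one]] by simp
    show "integrable M (\<lambda>x. (B + 1)\<^sup>2)" by simp
    fix n x
    have "\<bar>p n (sin (s * (x - a)))\<bar> \<le> B + 1"
      using p(2)[of "sin (s * (x - a))" n] B[of "sin (s * (x - a))"]
        inverse_le_1_iff[of "real (Suc n)"] by auto
    then show "cmod (of_real (p n (sin (s * (x - a))))) \<le> B + 1" by simp
  qed (auto intro!: tendsto_of_real lim)
qed

lemma cl_greaterThan: "indicator {a<..} \<in> cl"
proof -
  \<comment> \<open>Slowing the sine by n + 1 stretches its positive half-wave after a until it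
    contains any given x > a, and likewise its negative half-wave before a. At x the sine then
    decays only like (x - a) / (n + 1), so the factor (n + 1)^2 lifts it above 1 before
    clipping.\<close>
  define \<phi> where "\<phi> n s = min 1 (max 0 (real (Suc n) ^ 2 * s))" for n and s :: real
  define g where "g n x = \<phi> n (sin (inverse (real (Suc n)) * (x - a)))" for n x
  have "(\<lambda>n. g n x) \<longlonglongrightarrow> indicator {a<..} x" for x
  proof -
    define y where "y = x - a"
    have inv0: "(\<lambda>n. inverse (real (Suc n)) * y) \<longlonglongrightarrow> 0"
      using tendsto_mult_right[OF LIMSEQ_inverse_real_of_nat, of y] by simp
    show ?thesis
    proof (cases "y > 0")
      case True
      have d: "((\<lambda>h. sin h / h) \<longlongrightarrow> 1) (at (0::real))"
        using DERIV_sin[of "0::real"] by (simp add: DERIV_def)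
      have "(\<lambda>n. sin (inverse (real (Suc n)) * y) / (inverse (real (Suc n)) * y)) \<longlonglongrightarrow> 1"
        by (rule filterlim_compose[OF d])
           (use inv0 True in \<open>auto simp: filterlim_at\<close>)
      from order_tendstoD(1)[OF this, of "1/2"]
      have ev1: "\<forall>\<^sub>F n in sequentially. 1/2 < sin (inverse (real (Suc n)) * y) / (inverse (real (Suc n)) * y)"
        by simp
      have ev2: "\<forall>\<^sub>F n in sequentially. 2 / y < real (Suc n)"
        by (rule eventually_mono[OF filterlim_real_sequentially[unfolded filterlim_at_top_dense,
              rule_format, of "2 / y"]]) simp
      have "\<forall>\<^sub>F n in sequentially. g n x = 1"
        using ev1 ev2
      proof eventually_elim
        case (elim n)
        let ?N = "real (Suc n)"
        have N: "?N > 0" by simp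
        have "inverse ?N * y / 2 < sin (inverse ?N * y)"
          using elim(1) True N by (simp add: field_simps)
        then have "?N\<^sup>2 * (inverse ?N * y / 2) < ?N\<^sup>2 * sin (inverse ?N * y)"
          using N by (intro mult_strict_left_mono) auto
        moreover have "?N\<^sup>2 * (inverse ?N * y / 2) = ?N * y / 2"
          using N by (simp add: power2_eq_square)
        moreover have "?N * y / 2 > 1" using elim(2) True by (simp add: field_simps)
        ultimately have "1 < ?N\<^sup>2 * sin (inverse ?N * y)" by linarith
        then show ?case unfolding g_def \<phi>_def y_def[symmetric] by (simp del: of_nat_Suc)
      qed
      then show ?thesis using True by (simp add: tendsto_eventually y_def)
    next
      case False
      have "\<forall>\<^sub>F n in sequentially. g n x = 0"
        using order_tendstoD(1)[OF inv0, of "- pi", simplified]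
      proof eventually_elim
        case (elim n)
        have "inverse (real (Suc n)) * y \<le> 0"
          using False by (intro mult_nonneg_nonpos) auto
        then have "sin (inverse (real (Suc n)) * y) \<le> 0"
          using elim sin_ge_zero[of "- (inverse (real (Suc n)) * y)"] by auto
        then have "(real (Suc n))\<^sup>2 * sin (inverse (real (Suc n)) * y) \<le> 0"
          by (intro mult_nonneg_nonpos) auto
        then show ?case by (simp add: g_def \<phi>_def y_def)
      qed
      then show ?thesis using False by (simp add: tendsto_eventually y_def)
    qed
  qed note lim = this
  show ?thesis
  proof (rule cl_dominated)
    show "(\<lambda>x. of_real (g n x)) \<in> cl" for n
      unfolding g_def by (rule cl_continuous_sin) (auto simp: \<phi>_def intro!: continuous_intros)
    show "(\<lambda>n. complex_of_real (g n x)) \<longlonglongrightarrow> indicator {a<..} x" for x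
      using tendsto_of_real[OF lim[of x], where 'a=complex] by (simp add: indicator_def of_bool_def split: if_splits)
    show "integrable M (\<lambda>x. 1\<^sup>2 :: real)" by simp
    show "cmod (of_real (g n x)) \<le> 1" for n x by (simp add: g_def \<phi>_def)
  qed measurable
qed

lemma cl_indicator:
  assumes "A \<in> sets borel"
  shows "indicator A \<in> cl"
proof -
  have one: "(\<lambda>x. 1) \<in> cl" by (rule mlt_cl[OF mlt_one])
  have "{a<..} \<inter> {c<..} = {max a c<..}" for a c :: real by auto
  then have "Int_stable (range (greaterThan :: real \<Rightarrow> real set))"
    by (auto simp: Int_stable_def)
  moreover have "range greaterThan \<subseteq> Pow (UNIV :: real set)" by simp
  moreover have "A \<in> sigma_sets UNIV (range greaterThan)"
    using assms by (simp add: borel_Ioi)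
  ultimately show ?thesis
  proof (induction A rule: sigma_sets_induct_disjoint)
    case (basic A)
    then show ?case using cl_greaterThan by auto
  next
    case empty
    then show ?case using cl_zero by (simp add: indicator_def)
  next
    case (compl A)
    have "indicator (UNIV - A) = (\<lambda>x. 1 - indicator A x :: complex)"
      by (auto simp: indicator_def fun_eq_iff)
    then show ?case using cl_diff[OF one compl.IH] by simp
  next
    case (union A)
    have meas: "A i \<in> sets borel" for i using union.hyps(2) by (auto simp: borel_Ioi)
    show ?case
    proof (rule cl_dominated)
      show "(\<lambda>x. \<Sum>i<n. indicator (A i) x) \<in> cl" for n
        by (intro cl_sum union)
      have i: "(\<Sum>i<n. indicator (A i) x) = (indicator (\<Union>i<n. A i) x :: complex)" for n x
        using union.hyps(1) by (subst indicator_UN_disjoint) (auto simp: disjoint_family_on_def)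
      show "(\<lambda>n. \<Sum>i<n. indicator (A i) x) \<longlonglongrightarrow> (indicator (\<Union>i. A i) x :: complex)" for x
        unfolding i by (rule LIMSEQ_indicator_UN)
      show "integrable M (\<lambda>x. 1\<^sup>2 :: real)" by simp
      show "cmod (\<Sum>i<n. indicator (A i) x) \<le> 1" for n x
        unfolding i by (simp add: indicator_def)
      show "indicator (\<Union>i. A i) \<in> borel_measurable M"
        using meas by measurable
    qed
  qed
qed

text \<open>Simple functions are finite combinations of indicators, and they can be chosen below
  \<open>2 * cmod (f x)\<close>, which is square-integrable.\<close>

theorem L2_space_subset_cl: "L2_space M \<subseteq> cl"
proof
  fix f assume f: "f \<in> L2_space M"
  from f have fm: "f \<in> borel_measurable M" by (simp add: L2_space_def)
  obtain F where F: "\<And>i. simple_function M (F i)" "\<And>x. (\<lambda>i. F i x) \<longlonglongrightarrow> f x"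
    "\<And>i x. cmod (F i x) \<le> 2 * cmod (f x)"
    using borel_measurable_implies_sequence_metric[OF fm, of 0] by auto
  have "F i \<in> cl" for i
  proof -
    have *: "F i = (\<lambda>x. \<Sum>y\<in>range (F i). y * indicator (F i -` {y}) x)"
    proof
      fix x
      show "F i x = (\<Sum>y\<in>range (F i). y * indicator (F i -` {y}) x)"
        by (subst simple_function_indicator_representation_banach[OF F(1)[of i]])
           (auto simp: indicator_def intro!: sum.cong)
    qed
    have "F i -` {y} \<in> sets borel" for y
      using F(1)[of i] simple_functionD(2)[OF F(1)[of i], of "{y}"] by (simp add: sets_M)
    then show ?thesis
      by (subst *) (intro cl_sum cl_cmult cl_indicator)
  qed
  then show "f \<in> cl"
  proof (rule cl_dominated[OF fm, where w="\<lambda>x. 2 * cmod (f x)"])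
    show "integrable M (\<lambda>x. (2 * cmod (f x))\<^sup>2)"
      using f by (simp add: L2_space_def power_mult_distrib)
  qed (use F in auto)
qed

end

section \<open>Canonical Hadamard triples\<close>

locale canonical_triple =
  fixes b :: int and D C :: "int set"
  assumes canonical: "canonical_hadamard_triple b D C"
begin

lemma b_gt_2: "b > 2" and fin_D: "finite D" and fin_C: "finite C" and card_DC: "card D = card C"
  and zero_D: "0 \<in> D" and zero_C: "0 \<in> C" and Gcd_D: "Gcd D = 1" and C_range: "C \<subseteq> {0..b - 2}"
  using canonical by (auto simp: canonical_hadamard_triple_def integral_hadamard_triple_def)

lemma D_ne: "D \<noteq> {}" and card_D_pos: "card D > 0"
  using zero_D fin_D by (auto simp: card_gt_0_iff)

lemma ex_nonzero_D: "\<exists>d\<in>D. d \<noteq> 0"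
proof (rule ccontr)
  assume "\<not> (\<exists>d\<in>D. d \<noteq> 0)"
  then have "Gcd D = 0" by (simp add: Gcd_0_iff subset_eq)
  then show False using Gcd_D by simp
qed

text \<open>\<open>Gcd D = 1\<close> excludes \<open>D = {0}\<close>, so both sets have at least two
  elements.\<close>

lemma ex_nonzero_C: "\<exists>c\<in>C. c > 0"
proof -
  obtain d where "d \<in> D" "d \<noteq> 0" using ex_nonzero_D by auto
  then have "card {0, d} \<le> card D" using zero_D fin_D by (intro card_mono) auto
  then have "card C \<ge> 2" using \<open>d \<noteq> 0\<close> card_DC by simp
  then have "\<not> C \<subseteq> {0}" using card_mono[of "{0}" C] by (intro notI) simp
  then obtain c where "c \<in> C" "c \<noteq> 0" by auto
  then show ?thesis using C_range by (intro bexI[of _ c]) auto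
qed

section \<open>The mask and the Fourier transform of the self-similar measure\<close>

abbreviation \<mu> where "\<mu> \<equiv> self_similar_measure b D"

lemma self_similar: "is_self_similar b D \<mu>"
  using is_self_similar_self_similar_measure fin_D D_ne b_gt_2 by simp

sublocale \<mu>: real_distribution \<mu>
  using self_similar
  by (auto simp: is_self_similar_def real_distribution_def real_distribution_axioms_def)

text \<open>The characteristic function of the uniform distribution on \<open>D\<close>, rescaled to
  period 1. The sign is that of \<open>char\<close>, opposite to \<open>chi\<close>, whence the
  minus in \<open>integral_chi\<close>.\<close>

definition mask :: "real \<Rightarrow> complex" where
  "mask x = (\<Sum>d\<in>D. cis (2 * pi * (of_int d * x))) / of_nat (card D)"

definition ft :: "real \<Rightarrow> complex" where
  "ft x = char \<mu> (2 * pi * x)"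

lemma mask_0: "mask 0 = 1"
  using card_D_pos by (simp add: mask_def)

lemma mask_periodic: "mask (x + of_int k) = mask x"
proof -
  have "cis (2 * pi * (of_int d * (x + of_int k))) = cis (2 * pi * (of_int d * x))" for d :: int
  proof -
    have "cis (2 * pi * (of_int d * (x + of_int k)))
      = cis (2 * pi * (of_int d * x)) * cis (2 * pi * of_int (d * k))"
      by (simp add: cis_mult algebra_simps)
    also have "cis (2 * pi * of_int (d * k)) = 1" by (rule cis_multiple_2pi) simp
    finally show ?thesis by simp
  qed
  then show ?thesis by (simp add: mask_def)
qed

lemma continuous_mask: "isCont mask x"
  unfolding mask_def cis_conv_exp by (intro continuous_intros) (use card_D_pos in auto)

lemma hadamard_entry:
  "1 / of_real (sqrt (of_nat (card D))) *
     exp (- (2 * of_real pi * \<i> * of_int c * of_int d / of_int b))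
   = cis (- (2 * pi * (of_int c * of_int d / of_int b))) / of_real (sqrt (real (card D)))"
  by (simp add: cis_conv_exp mult_ac)

lemma unitary: "unitary_matrix_on D C
    (\<lambda>d c. cis (- (2 * pi * (of_int c * of_int d / of_int b))) / of_real (sqrt (real (card D))))"
  using canonical unfolding canonical_hadamard_triple_def integral_hadamard_triple_def hadamard_entry
  by blast

lemma mask_orthogonal:
  assumes "c \<in> C" "c' \<in> C" "c \<noteq> c'"
  shows "mask (of_int (c - c') / of_int b) = 0"
proof -
  define r where "r = complex_of_real (sqrt (real (card D)))"
  have rr: "r * r = of_nat (card D)" "cnj r = r"
    by (simp_all add: r_def flip: of_real_mult)
  have col: "\<forall>c\<in>C. \<forall>c'\<in>C.
      (\<Sum>d\<in>D. cnj (cis (- (2 * pi * (of_int c * of_int d / of_int b))) / r)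
      * (cis (- (2 * pi * (of_int c' * of_int d / of_int b))) / r)) = (if c = c' then 1 else 0)"
    using unitary unfolding unitary_matrix_on_def r_def by blast
  have "(\<Sum>d\<in>D. cnj (cis (- (2 * pi * (of_int c * of_int d / of_int b))) / r)
      * (cis (- (2 * pi * (of_int c' * of_int d / of_int b))) / r)) = 0"
    using col[rule_format, OF assms(1,2)] assms(3) by (simp only: if_False)
  moreover have "cnj (cis (- (2 * pi * (of_int c * of_int d / of_int b))) / r)
      * (cis (- (2 * pi * (of_int c' * of_int d / of_int b))) / r)
    = cis (2 * pi * (of_int d * (of_int (c - c') / of_int b))) / of_nat (card D)" for d
    unfolding complex_cnj_divide cis_cnj rr times_divide_times_eq cis_mult
    by (simp add: algebra_simps diff_divide_distrib)
  ultimately show ?thesis by (simp add: mask_def sum_divide_distrib)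
qed

lemma rows_orthogonal:
  assumes "d \<in> D" "d' \<in> D"
  shows "(\<Sum>c\<in>C. cis (2 * pi * (of_int c * of_int d / of_int b))
      * cnj (cis (2 * pi * (of_int c * of_int d' / of_int b))))
    = (if d = d' then of_nat (card D) else 0)"
proof -
  define r where "r = complex_of_real (sqrt (real (card D)))"
  have rr: "r * r = of_nat (card D)" "cnj r = r"
    by (simp_all add: r_def flip: of_real_mult)
  have row: "\<forall>d\<in>D. \<forall>d'\<in>D.
      (\<Sum>c\<in>C. cis (- (2 * pi * (of_int c * of_int d / of_int b))) / r
      * cnj (cis (- (2 * pi * (of_int c * of_int d' / of_int b))) / r)) = (if d = d' then 1 else 0)"
    using unitary unfolding unitary_matrix_on_def r_def by blast
  have "(\<Sum>c\<in>C. cis (- (2 * pi * (of_int c * of_int d' / of_int b))) / r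
      * cnj (cis (- (2 * pi * (of_int c * of_int d / of_int b))) / r)) = (if d' = d then 1 else 0)"
    using row[rule_format, OF assms(2,1)] .
  moreover have "cis (- (2 * pi * (of_int c * of_int d' / of_int b))) / r
      * cnj (cis (- (2 * pi * (of_int c * of_int d / of_int b))) / r)
    = (cis (2 * pi * (of_int c * of_int d / of_int b))
      * cnj (cis (2 * pi * (of_int c * of_int d' / of_int b)))) / of_nat (card D)" for c
    unfolding complex_cnj_divide cis_cnj rr times_divide_times_eq by (simp add: mult.commute)
  ultimately have "(\<Sum>c\<in>C. cis (2 * pi * (of_int c * of_int d / of_int b))
      * cnj (cis (2 * pi * (of_int c * of_int d' / of_int b)))) / of_nat (card D)
    = (if d' = d then 1 else 0)" (is "?S / _ = _")
    by (simp only: sum_divide_distrib)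
  moreover have "?S = ?S / of_nat (card D) * of_nat (card D)" using card_D_pos by simp
  ultimately show ?thesis by (simp only:) auto
qed

text \<open>Parseval: the numbers \<open>A d / sqrt (card D)\<close> form a unit vector, and the
  masks are its coordinates after applying the unitary matrix with entries
  \<open>E d c / sqrt (card D)\<close>.\<close>

lemma sum_mask_square: "(\<Sum>c\<in>C. (cmod (mask ((x + of_int c) / of_int b)))\<^sup>2) = 1"
proof -
  define n where "n = complex_of_nat (card D)"
  define A where "A d = cis (2 * pi * (of_int d * x / of_int b))" for d :: int
  define E where "E d c = cis (2 * pi * (of_int c * of_int d / of_int b))" for d c :: int
  have n0: "n \<noteq> 0" using card_D_pos by (simp add: n_def)
  have m: "mask ((x + of_int c) / of_int b) = (\<Sum>d\<in>D. A d * E d c) / n" for c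
    by (simp add: mask_def A_def E_def n_def cis_mult add_divide_distrib algebra_simps)
  have AA: "A d * cnj (A d) = 1" for d by (simp add: A_def cis_cnj cis_mult)
  have "complex_of_real (\<Sum>c\<in>C. (cmod (mask ((x + of_int c) / of_int b)))\<^sup>2)
    = (\<Sum>c\<in>C. mask ((x + of_int c) / of_int b) * cnj (mask ((x + of_int c) / of_int b)))"
    by (simp only: of_real_sum complex_norm_square)
  also have "\<dots> = (\<Sum>c\<in>C. (\<Sum>d\<in>D. \<Sum>d'\<in>D. (A d * cnj (A d')) * (E d c * cnj (E d' c)))) / (n * n)"
    unfolding m
    by (simp add: sum_product n_def mult_ac flip: sum_divide_distrib)
  also have "(\<Sum>c\<in>C. (\<Sum>d\<in>D. \<Sum>d'\<in>D. (A d * cnj (A d')) * (E d c * cnj (E d' c))))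
    = (\<Sum>d\<in>D. \<Sum>d'\<in>D. \<Sum>c\<in>C. (A d * cnj (A d')) * (E d c * cnj (E d' c)))"
    by (subst sum.swap) (intro sum.cong refl sum.swap)
  also have "\<dots> = (\<Sum>d\<in>D. \<Sum>d'\<in>D. (A d * cnj (A d')) * (if d = d' then n else 0))"
    unfolding sum_distrib_left[symmetric] E_def n_def
    by (intro sum.cong refl arg_cong2[where f="(*)"] rows_orthogonal)
  also have "\<dots> = (\<Sum>d\<in>D. n)"
    using fin_D by (intro sum.cong refl) (simp add: if_distrib[of "\<lambda>x. _ * x"] AA cong: if_cong)
  also have "\<dots> / (n * n) = 1" using n0 by (simp add: n_def)
  finally show ?thesis by (simp only: of_real_eq_1_iff)
qed

text \<open>Iterated, this is the product of the values \<open>mask (x / b ^ j)\<close> for j >= 1;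
  all zeros of \<open>ft\<close> used below come from one of these factors.\<close>

lemma ft_rec: "ft x = mask (x / of_int b) * ft (x / of_int b)"
  using char_self_similar[OF fin_D D_ne self_similar, of "2 * pi * x"]
  by (simp add: ft_def mask_def cis_conv_exp mult_ac)

lemma ft_0: "ft 0 = 1"
  by (simp add: ft_def \<mu>.char_zero)

lemma continuous_ft: "isCont ft x"
  unfolding ft_def by (rule isCont_o2[OF _ \<mu>.isCont_char]) simp

lemma norm_ft_le: "cmod (ft x) \<le> 1"
  unfolding ft_def by (rule \<mu>.cmod_char_le_1)

lemma integral_chi: "(LINT x|\<mu>. chi k x) = ft (- k)"
  unfolding ft_def char_def by (rule Bochner_Integration.integral_cong) (auto simp: chi_def mult_ac)

lemma cnj_ft: "cnj (ft x) = ft (- x)"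
proof -
  have "cnj (ft x) = cnj (LINT y|\<mu>. chi (- x) y)" by (simp add: integral_chi)
  also have "\<dots> = (LINT y|\<mu>. cnj (chi (- x) y))" by simp
  also have "\<dots> = ft (- x)" by (simp add: cnj_chi integral_chi)
  finally show ?thesis .
qed

lemma integrable_chi [simp]: "integrable \<mu> (chi k)"
  by (rule \<mu>.integrable_const_bound[where B=1]) auto

lemma L2_inner_chi: "L2_inner \<mu> (chi k) (chi l) = ft (l - k)"
proof -
  have "chi k x * cnj (chi l x) = chi (k - l) x" for x
    using chi_add[of k "- l" x] by (simp add: cnj_chi)
  then show ?thesis by (simp add: L2_inner_def integral_chi)
qed

text \<open>The coefficients are left arbitrary because there are two uses: Fourier coefficients for
  the projection of a character, and unknown coefficients where the middle term vanishes.\<close>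

lemma chi_dist:
  assumes F: "finite F" and orth: "\<And>l l'. l \<in> F \<Longrightarrow> l' \<in> F \<Longrightarrow> l \<noteq> l' \<Longrightarrow> ft (l - l') = 0"
  shows "(LINT x|\<mu>. (cmod (chi y x - (\<Sum>l\<in>F. a l * chi l x)))\<^sup>2)
    = 1 - 2 * Re (\<Sum>l\<in>F. cnj (a l) * ft (l - y)) + (\<Sum>l\<in>F. (cmod (a l))\<^sup>2)"
proof -
  have e: "chi k x * cnj (chi l x) = chi (k - l) x" for k l x
    using chi_add[of k "- l" x] by (simp add: cnj_chi)
  have "complex_of_real ((cmod (chi y x - (\<Sum>l\<in>F. a l * chi l x)))\<^sup>2)
    = 1 - (\<Sum>l\<in>F. cnj (a l) * chi (y - l) x) - (\<Sum>l\<in>F. a l * chi (l - y) x)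
      + (\<Sum>l\<in>F. \<Sum>l'\<in>F. (a l * cnj (a l')) * chi (l - l') x)" for x
  proof -
    have "complex_of_real ((cmod (chi y x - (\<Sum>l\<in>F. a l * chi l x)))\<^sup>2)
      = (chi y x - (\<Sum>l\<in>F. a l * chi l x)) * (cnj (chi y x) - (\<Sum>l\<in>F. cnj (a l) * cnj (chi l x)))"
      by (simp only: complex_norm_square complex_cnj_diff cnj_sum complex_cnj_mult)
    also have "\<dots> = chi y x * cnj (chi y x) - (\<Sum>l\<in>F. cnj (a l) * (chi y x * cnj (chi l x)))
      - (\<Sum>l\<in>F. a l * (chi l x * cnj (chi y x)))
      + (\<Sum>l\<in>F. \<Sum>l'\<in>F. (a l * cnj (a l')) * (chi l x * cnj (chi l' x)))"
      by (simp add: algebra_simps sum_product sum_distrib_left sum_distrib_right) (rule sum.swap)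
    finally show ?thesis unfolding e by simp
  qed
  then have "complex_of_real (LINT x|\<mu>. (cmod (chi y x - (\<Sum>l\<in>F. a l * chi l x)))\<^sup>2)
    = (LINT x|\<mu>. 1 - (\<Sum>l\<in>F. cnj (a l) * chi (y - l) x) - (\<Sum>l\<in>F. a l * chi (l - y) x)
      + (\<Sum>l\<in>F. \<Sum>l'\<in>F. (a l * cnj (a l')) * chi (l - l') x))"
    by (simp only: integral_complex_of_real[symmetric])
  also have "\<dots> = 1 - (\<Sum>l\<in>F. cnj (a l) * ft (l - y)) - (\<Sum>l\<in>F. a l * ft (y - l))
      + (\<Sum>l\<in>F. \<Sum>l'\<in>F. (a l * cnj (a l')) * ft (l' - l))"
    by (simp add: integral_chi \<mu>.prob_space[simplified])
  also have "(\<Sum>l\<in>F. \<Sum>l'\<in>F. (a l * cnj (a l')) * ft (l' - l))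
    = (\<Sum>l\<in>F. \<Sum>l'\<in>F. if l' = l then a l * cnj (a l) else 0)"
    using orth by (intro sum.cong refl) (auto simp: ft_0)
  also have "\<dots> = (\<Sum>l\<in>F. a l * cnj (a l))"
    using F by simp
  also have "\<dots> = of_real (\<Sum>l\<in>F. (cmod (a l))\<^sup>2)"
    by (simp only: of_real_sum complex_norm_square)
  also have "(\<Sum>l\<in>F. a l * ft (y - l)) = cnj (\<Sum>l\<in>F. cnj (a l) * ft (l - y))"
    by (simp add: cnj_ft)
  finally have "Re (complex_of_real (LINT x|\<mu>. (cmod (chi y x - (\<Sum>l\<in>F. a l * chi l x)))\<^sup>2))
    = Re (1 - (\<Sum>l\<in>F. cnj (a l) * ft (l - y)) - cnj (\<Sum>l\<in>F. cnj (a l) * ft (l - y))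
      + of_real (\<Sum>l\<in>F. (cmod (a l))\<^sup>2))" by (rule arg_cong)
  then show ?thesis by (simp only: Re_complex_of_real plus_complex.simps minus_complex.simps complex_cnj one_complex.simps cnj.sel)
qed

section \<open>Digit expansions and orthogonality\<close>

fun Lam :: "nat \<Rightarrow> int set" where
  "Lam 0 = {0}"
| "Lam (Suc k) = (\<lambda>(c, l). c + b * l) ` (C \<times> Lam k)"

lemma finite_Lam: "finite (Lam k)"
  by (induction k) (auto simp: fin_C)

lemma Lam_Suc_mono: "Lam k \<subseteq> Lam (Suc k)"
proof (induction k)
  case 0
  then show ?case using zero_C by (auto intro!: image_eqI[of _ _ "(0, 0)"])
next
  case (Suc k)
  then show ?case by (simp only: Lam.simps(2)) (intro image_mono Sigma_mono, auto)
qed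

lemma Lam_mono: "j \<le> k \<Longrightarrow> Lam j \<subseteq> Lam k"
  by (rule lift_Suc_mono_le[of Lam, OF Lam_Suc_mono])

text \<open>\<open>Lam\<close> splits off the lowest digit, the one that the first mask factor in
  \<open>ft_rec\<close> sees; the digit sums of \<open>canonical_spectrum\<close> have to be brought
  into that form.\<close>

lemma Lam_digits: "Lam k = {(\<Sum>j<k. b ^ j * c j) | c :: nat \<Rightarrow> int. \<forall>j<k. c j \<in> C}"
proof (induction k)
  case 0
  then show ?case by auto
next
  case (Suc k)
  show ?case
  proof (intro equalityI subsetI)
    fix x assume "x \<in> Lam (Suc k)"
    then obtain c0 c where c: "c0 \<in> C" "\<forall>j<k. c j \<in> C" "x = c0 + b * (\<Sum>j<k. b ^ j * c j)"
      using Suc by auto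
    then have "x = (\<Sum>j<Suc k. b ^ j * case_nat c0 c j)"
      by (simp only: sum.lessThan_Suc_shift) (simp add: sum_distrib_left mult_ac)
    moreover have "\<forall>j<Suc k. case_nat c0 c j \<in> C" using c by (auto split: nat.split)
    ultimately show "x \<in> {(\<Sum>j<Suc k. b ^ j * c j) | c. \<forall>j<Suc k. c j \<in> C}" by blast
  next
    fix x assume "x \<in> {(\<Sum>j<Suc k. b ^ j * c j) | c. \<forall>j<Suc k. c j \<in> C}"
    then obtain c where c: "\<forall>j<Suc k. c j \<in> C" "x = (\<Sum>j<Suc k. b ^ j * c j)" by blast
    have "x = c 0 + b * (\<Sum>j<k. b ^ j * c (Suc j))"
      unfolding c(2) sum.lessThan_Suc_shift by (simp add: sum_distrib_left mult_ac)
    moreover have "(\<Sum>j<k. b ^ j * c (Suc j)) \<in> Lam k" unfolding Suc using c(1) by auto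
    ultimately show "x \<in> Lam (Suc k)" using c(1) by auto
  qed
qed

lemma canonical_spectrum_eq: "canonical_spectrum b C = (\<Union>k. Lam k)"
proof -
  have "canonical_spectrum b C = (\<Union>k\<in>{1..}. Lam k)"
    by (simp add: canonical_spectrum_def Lam_digits)
  also have "\<dots> = (\<Union>k. Lam k)"
    using Lam_Suc_mono by (force simp del: Lam.simps)
  finally show ?thesis .
qed

text \<open>Concatenation of digit strings, with l in the low places; it allows a block of digits to
  be repeated.\<close>

lemma Lam_append:
  assumes "l \<in> Lam j" "l' \<in> Lam k"
  shows "l + b ^ j * l' \<in> Lam (j + k)"
  using assms(1)
proof (induction j arbitrary: l)
  case 0
  then show ?case using assms by simp
next
  case (Suc j)
  then obtain c m where m: "c \<in> C" "m \<in> Lam j" "l = c + b * m" by auto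
  have "l + b ^ Suc j * l' = c + b * (m + b ^ j * l')" by (simp add: m algebra_simps)
  then show ?case
    using m(1) Suc.IH[OF m(2)] by (auto intro!: image_eqI[of _ _ "(c, m + b ^ j * l')"])
qed

lemma digit_inj:
  assumes "c \<in> C" "c' \<in> C" "c + b * l = c' + b * l'"
  shows "c = c' \<and> l = l'"
proof -
  have "d mod b = d" if "d \<in> C" for d
    using that C_range by (intro mod_pos_pos_trivial) force+
  then have "c = (c + b * l) mod b" "c' = (c' + b * l') mod b" using assms(1,2) by simp_all
  then have "c = c'" using assms(3) by simp
  then show ?thesis using assms(3) b_gt_2 by simp
qed

text \<open>The two digit expansions first differ at some position \<open>j < k\<close>; there the factor of the
  infinite product is a zero of the mask, and the multiple of \<open>b ^ k\<close> is invisible to it.\<close>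

lemma ft_zero:
  assumes "t mod b = 1" "l \<in> Lam k" "l' \<in> Lam k" "l \<noteq> l'"
  shows "ft (of_int (t * (l - l') + b ^ k * z)) = 0"
  using assms(2-)
proof (induction k arbitrary: l l')
  case 0
  then show ?case by simp
next
  case (Suc k)
  obtain c m where m: "c \<in> C" "m \<in> Lam k" "l = c + b * m" using Suc.prems(1) by auto
  obtain c' m' where m': "c' \<in> C" "m' \<in> Lam k" "l' = c' + b * m'" using Suc.prems(2) by auto
  let ?y = "t * (l - l') + b ^ Suc k * z"
  show ?case
  proof (cases "c = c'")
    case True
    have "?y = b * (t * (m - m') + b ^ k * z)" by (simp add: m m' True algebra_simps)
    then have "real_of_int ?y / of_int b = of_int (t * (m - m') + b ^ k * z)"
      using b_gt_2 by (simp only: of_int_mult) simp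
    moreover have "m \<noteq> m'" using Suc.prems m m' True by auto
    ultimately show ?thesis
      using Suc.IH[OF m(2) m'(2) \<open>m \<noteq> m'\<close>] by (subst ft_rec) (simp only: mult_zero_right)
  next
    case False
    define s where "s = t div b"
    have s: "t = 1 + b * s" using assms(1) mult_div_mod_eq[of b t] by (simp add: s_def)
    \<comment> \<open>Since t is 1 modulo b, the lowest digit difference survives multiplication by
      t, and the argument of the mask is (c - c') / b up to an integer.\<close>
    have "?y = (c - c') + b * (s * (c - c') + t * (m - m') + b ^ k * z)"
      by (simp add: m m' s algebra_simps)
    then have "real_of_int ?y / of_int b
      = of_int (c - c') / of_int b + of_int (s * (c - c') + t * (m - m') + b ^ k * z)"
      using b_gt_2 by (simp only: of_int_add of_int_mult) (simp add: field_simps)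
    then have "mask (real_of_int ?y / of_int b) = 0"
      by (simp only: mask_periodic mask_orthogonal[OF m(1) m'(1) False])
    then show ?thesis by (subst ft_rec) (simp only: mult_zero_left)
  qed
qed

lemma ft_spectrum_orthogonal:
  assumes "l \<in> canonical_spectrum b C" "l' \<in> canonical_spectrum b C" "l \<noteq> l'"
  shows "ft (of_int l - of_int l') = 0"
proof -
  obtain j j' where "l \<in> Lam j" "l' \<in> Lam j'" using assms by (auto simp: canonical_spectrum_eq)
  then have "l \<in> Lam (max j j')" "l' \<in> Lam (max j j')"
    using Lam_mono[of j "max j j'"] Lam_mono[of j' "max j j'"] by auto
  then show ?thesis using ft_zero[of 1 l "max j j'" l' 0] assms b_gt_2 by simp
qed

section \<open>Sums of squared Fourier coefficients\<close>

definition Q :: "nat \<Rightarrow> real \<Rightarrow> real" where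
  "Q k x = (\<Sum>l\<in>Lam k. (cmod (ft (x + of_int l)))\<^sup>2)"

text \<open>Dividing x + c + b * l by b leaves the integer shift l, which the mask ignores by
  periodicity; so its factor depends on the lowest digit c alone.\<close>

lemma Q_Suc:
  "Q (Suc k) x = (\<Sum>c\<in>C. (cmod (mask ((x + of_int c) / of_int b)))\<^sup>2 * Q k ((x + of_int c) / of_int b))"
proof -
  have "inj_on (\<lambda>(c, l). c + b * l) (C \<times> Lam k)"
    unfolding inj_on_def by (auto dest: digit_inj)
  then have "Q (Suc k) x = (\<Sum>(c, l)\<in>C \<times> Lam k. (cmod (ft (x + of_int (c + b * l))))\<^sup>2)"
    unfolding Q_def Lam.simps by (subst sum.reindex) (auto simp: case_prod_unfold)
  also have "\<dots> = (\<Sum>c\<in>C. \<Sum>l\<in>Lam k. (cmod (ft (x + of_int (c + b * l))))\<^sup>2)"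
    by (simp add: sum.cartesian_product)
  also have "\<dots> = (\<Sum>c\<in>C. (cmod (mask ((x + of_int c) / of_int b)))\<^sup>2 * Q k ((x + of_int c) / of_int b))"
    unfolding Q_def sum_distrib_left
  proof (intro sum.cong refl)
    fix c l
    have "(x + of_int (c + b * l)) / of_int b = (x + of_int c) / of_int b + of_int l"
      using b_gt_2 by (simp add: field_simps)
    then have "ft (x + of_int (c + b * l))
      = mask ((x + of_int c) / of_int b) * ft ((x + of_int c) / of_int b + of_int l)"
      unfolding ft_rec[of "x + of_int (c + b * l)"] by (simp only: mask_periodic)
    then show "(cmod (ft (x + of_int (c + b * l))))\<^sup>2 = (cmod (mask ((x + of_int c) / of_int b)))\<^sup>2
      * (cmod (ft ((x + of_int c) / of_int b + of_int l)))\<^sup>2"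
      by (simp add: norm_mult power_mult_distrib)
  qed
  finally show ?thesis .
qed

text \<open>Bessel's inequality, obtained from averaging with weights of total mass 1 instead of
  from orthogonality.\<close>

lemma Q_le_1: "Q k x \<le> 1"
proof (induction k arbitrary: x)
  case 0
  then show ?case using norm_ft_le[of x] by (simp add: Q_def power_le_one)
next
  case (Suc k)
  have "Q (Suc k) x \<le> (\<Sum>c\<in>C. (cmod (mask ((x + of_int c) / of_int b)))\<^sup>2 * 1)"
    unfolding Q_Suc by (intro sum_mono mult_left_mono Suc) auto
  then show ?case by (simp add: sum_mask_square)
qed

lemma Q_incseq: "incseq (\<lambda>k. Q k x)"
  unfolding Q_def by (intro incseq_SucI sum_mono2 finite_Lam Lam_Suc_mono) simp

lemma continuous_Q: "continuous_on UNIV (Q k)"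
proof -
  have "continuous_on UNIV ft" using continuous_ft by (simp add: continuous_on_eq_continuous_at)
  then have "continuous_on UNIV (\<lambda>x. ft (x + of_int l))" for l
    by (rule continuous_on_compose2) (auto intro!: continuous_intros)
  then show ?thesis unfolding Q_def by (intro continuous_intros)
qed

text \<open>\<open>q (- y)\<close> is the squared norm of the projection of \<open>chi y\<close> to the closed span of the characters
  with frequencies in the canonical spectrum.\<close>

definition q :: "real \<Rightarrow> real" where
  "q x = (SUP k. Q k x)"

lemma Q_bdd: "bdd_above (range (\<lambda>k. Q k x))"
  using Q_le_1 by (auto simp: bdd_above_def)

lemma Q_tendsto: "(\<lambda>k. Q k x) \<longlonglongrightarrow> q x"
  unfolding q_def using Q_bdd Q_incseq by (rule LIMSEQ_incseq_SUP)

lemma Q_le_q: "Q k x \<le> q x"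
  unfolding q_def by (rule cSUP_upper[OF UNIV_I Q_bdd])

lemma q_le_iff: "q x \<le> m \<longleftrightarrow> (\<forall>k. Q k x \<le> m)"
  unfolding q_def using Q_bdd by (subst cSUP_le_iff) auto

lemma q_nonneg: "0 \<le> q x"
  by (rule order_trans[OF _ Q_le_q[of 0]]) (simp add: Q_def)

lemma q_le_1: "q x \<le> 1"
  by (simp add: q_le_iff Q_le_1)

lemma q_0: "q 0 = 1"
  using Q_le_q[of 0 0] q_le_1[of 0] by (simp add: Q_def ft_0)

lemma q_rec:
  "q x = (\<Sum>c\<in>C. (cmod (mask ((x + of_int c) / of_int b)))\<^sup>2 * q ((x + of_int c) / of_int b))"
proof (rule LIMSEQ_unique)
  show "(\<lambda>k. Q (Suc k) x) \<longlonglongrightarrow> q x"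
    using Q_tendsto by (rule LIMSEQ_Suc)
  show "(\<lambda>k. Q (Suc k) x) \<longlonglongrightarrow>
    (\<Sum>c\<in>C. (cmod (mask ((x + of_int c) / of_int b)))\<^sup>2 * q ((x + of_int c) / of_int b))"
    unfolding Q_Suc by (intro tendsto_intros Q_tendsto)
qed

section \<open>Zeros and maximum modulus of the mask\<close>

lemma finite_mask_zeros: "finite {x \<in> {-1..1}. mask x = 0}"
proof -
  \<comment> \<open>An entire extension of the mask, up to the factor \<open>card D\<close>. It
    vanishes at c / b but not at 0, so it is not constant and has finitely many zeros on a compact
    segment.\<close>
  define F where "F z = (\<Sum>d\<in>D. exp (\<i> * of_real (2 * pi) * of_int d * z))" for z
  have F: "F (of_real x) = mask x * of_nat (card D)" for x
    using card_D_pos by (simp add: F_def mask_def cis_conv_exp mult_ac)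
  obtain c where c: "c \<in> C" "c > 0" using ex_nonzero_C by auto
  have "F (of_real 0) \<noteq> F (of_real (of_int (c - 0) / of_int b))"
    unfolding F using mask_orthogonal[OF c(1) zero_C] c(2) card_D_pos by (simp add: mask_0)
  then have "\<not> F constant_on UNIV" unfolding constant_on_def by (metis UNIV_I)
  moreover have "F holomorphic_on UNIV"
    unfolding F_def by (intro holomorphic_intros)
  moreover have "compact (complex_of_real ` {-1..1})"
    by (intro compact_continuous_image continuous_intros compact_Icc)
  ultimately have "finite {z \<in> complex_of_real ` {-1..1}. F z = 0}"
    by (intro holomorphic_compact_finite_zeros[of F UNIV]) auto
  moreover have "complex_of_real ` {x \<in> {-1..1}. mask x = 0} \<subseteq> {z \<in> complex_of_real ` {-1..1}. F z = 0}"
    by (auto simp: F)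
  ultimately have "finite (complex_of_real ` {x \<in> {-1..1}. mask x = 0})"
    by (rule rev_finite_subset)
  then show ?thesis by (rule finite_imageD) (simp add: inj_on_def)
qed

text \<open>Equality in the triangle inequality forces every \<open>cis (2 * pi * d * x)\<close> to equal the term of
  \<open>d = 0\<close>, and \<open>Gcd D = 1\<close> turns this into integrality of \<open>x\<close>.\<close>

lemma norm_mask_1_imp_int:
  assumes "cmod (mask x) = 1"
  shows "x \<in> \<int>"
proof -
  have dx: "of_int d * x \<in> \<int>" if "d \<in> D" "d \<noteq> 0" for d
  proof -
    let ?e = "\<lambda>d :: int. cis (2 * pi * (of_int d * x))"
    have "(\<Sum>d\<in>D. ?e d) = (1 + ?e d) + (\<Sum>d\<in>D - {0, d}. ?e d)"
      using sum.subset_diff[of "{0, d}" D ?e] fin_D that zero_D by (simp add: add_ac)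
    moreover have "cmod (\<Sum>d\<in>D - {0, d}. ?e d) \<le> (\<Sum>d\<in>D - {0, d}. cmod (?e d))"
      by (rule norm_sum)
    moreover have "card (D - {0, d}) = card D - 2"
      using fin_D that zero_D by (simp add: card_Diff_subset)
    moreover have "card {0, d} \<le> card D" using that zero_D fin_D by (intro card_mono) auto
    ultimately have "cmod (\<Sum>d\<in>D. ?e d) \<le> cmod (1 + ?e d) + (real (card D) - 2)"
      using norm_triangle_ineq[of "1 + ?e d" "\<Sum>d\<in>D - {0, d}. ?e d"] that by (simp add: of_nat_diff)
    moreover have "cmod (\<Sum>d\<in>D. ?e d) = real (card D)"
      using assms card_D_pos by (simp add: mask_def norm_divide)
    ultimately have "2 \<le> cmod (1 + ?e d)" by simp
    then have "2\<^sup>2 \<le> (cmod (1 + ?e d))\<^sup>2" by (intro power_mono) auto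
    also have "(cmod (1 + cis t))\<^sup>2 = 2 + 2 * cos t" for t
      using sin_cos_squared_add[of t] by (simp add: cmod_power2 power2_sum)
    finally have "cos (2 * pi * (of_int d * x)) = 1"
      using cos_le_one[of "2 * pi * (of_int d * x)"] by simp
    then obtain n :: int where "2 * pi * (of_int d * x) = of_int n * 2 * pi"
      by (auto simp: cos_one_2pi_int)
    then have "of_int d * x = of_int n" by simp
    then show ?thesis by simp
  qed
  \<comment> \<open>One nonzero d0 makes x rational; the reduced denominator e of x then divides
    every element of \<open>D\<close>, hence their gcd.\<close>
  obtain d0 where d0: "d0 \<in> D" "d0 \<noteq> 0" using ex_nonzero_D by auto
  obtain m where m: "of_int d0 * x = of_int m" using dx[OF d0] by (auto elim: Ints_cases)
  define g where "g = gcd m d0"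
  have g0: "g \<noteq> 0" using d0 by (simp add: g_def)
  obtain p e where pe: "m = p * g" "d0 = e * g" "coprime p e"
    using gcd_coprime_exists[of m d0] g0 unfolding g_def by blast
  have e0: "e \<noteq> 0" using pe d0 by auto
  have x: "x = of_int p / of_int e"
    using m g0 e0 by (simp add: pe field_simps)
  have "e dvd d" if "d \<in> D" for d
  proof (cases "d = 0")
    case False
    then have "of_int d * x \<in> \<int>" using dx that by simp
    then obtain n where "of_int d * x = of_int n" by (auto elim: Ints_cases)
    then have "real_of_int (d * p) = real_of_int (n * e)" using e0 by (simp add: x field_simps)
    then have "d * p = n * e" by (simp only: of_int_eq_iff)
    then have "e dvd d * p" by simp
    then show ?thesis using pe(3) by (simp add: coprime_dvd_mult_left_iff coprime_commute)
  qed simp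
  then have "e dvd Gcd D" by (rule Gcd_greatest)
  then have "e dvd 1" by (simp only: Gcd_D)
  then have "\<bar>e\<bar> = 1" by (simp only: zdvd1_eq)
  then have "e = 1 \<or> e = -1" by linarith
  then show ?thesis by (auto simp: x)
qed

text \<open>Fixed point of the branch \<open>x \<mapsto> (x + (b - 2)) / b\<close> of the largest admissible digit, hence an upper
  bound for the attractor of the maps \<open>x \<mapsto> (x + c) / b\<close>.\<close>

definition top_pt :: real where
  "top_pt = (of_int b - 2) / (of_int b - 1)"

lemma top_pt: "0 \<le> top_pt" "top_pt < 1" "(top_pt + (of_int b - 2)) / of_int b = top_pt"
  using b_gt_2 by (simp_all add: top_pt_def field_simps)

text \<open>Each branch contracts the excess over \<open>[0, top_pt]\<close> by the factor b. This
  makes a neighbourhood invariant, and read backwards it carries identities outwards to the whole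
  line.\<close>

lemma preimage_bounds:
  assumes "c \<in> C" "-s \<le> x" "x \<le> top_pt + s"
  shows "- (s / of_int b) \<le> (x + of_int c) / of_int b"
    and "(x + of_int c) / of_int b \<le> top_pt + s / of_int b"
proof -
  have b: "real_of_int b > 0" using b_gt_2 by simp
  have c: "0 \<le> real_of_int c" "real_of_int c \<le> of_int b - 2" using assms(1) C_range by auto
  show "- (s / of_int b) \<le> (x + of_int c) / of_int b"
    using divide_right_mono[of "- s" "x + of_int c" "of_int b"] assms b c by simp
  have "(x + of_int c) / of_int b \<le> (top_pt + s + (of_int b - 2)) / of_int b"
    using assms b c by (intro divide_right_mono) auto
  also have "\<dots> = (top_pt + (of_int b - 2)) / of_int b + s / of_int b"
    by (simp add: add_divide_distrib diff_divide_distrib)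
  finally show "(x + of_int c) / of_int b \<le> top_pt + s / of_int b" by (simp only: top_pt(3))
qed

section \<open>The minimum principle for \<open>q\<close>\<close>

lemma q_attains_min:
  assumes "x0 \<in> {u..v}"
  obtains x where "x \<in> {u..v}" "\<And>y. y \<in> {u..v} \<Longrightarrow> q x \<le> q y"
proof -
  define m where "m = (INF y\<in>{u..v}. q y)"
  have bdd: "bdd_below (q ` {u..v})" using q_nonneg by (auto simp: bdd_below_def)
  define F where "F n = {x \<in> {u..v}. q x \<le> m + inverse (real (Suc n))}" for n
  \<comment> \<open>Lower semicontinuity: a sublevel set of the supremum is the intersection of the
    closed sublevel sets of the \<open>Q k\<close>. The nested compact sets \<open>F n\<close> then
    have a common point.\<close>
  have "F n = {u..v} \<inter> (\<Inter>k. {x. Q k x \<le> m + inverse (real (Suc n))})" for n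
    by (auto simp: F_def q_le_iff)
  moreover have "closed (\<Inter>k. {x. Q k x \<le> r})" for r
    by (intro closed_INT ballI closed_Collect_le continuous_Q continuous_on_const)
  ultimately have "compact (F n)" for n by (simp only: compact_Int_closed compact_Icc)
  moreover have "F n \<noteq> {}" for n
  proof -
    have "\<exists>y\<in>q ` {u..v}. y < m + inverse (real (Suc n))"
    proof (rule ccontr)
      assume "\<not> (\<exists>y\<in>q ` {u..v}. y < m + inverse (real (Suc n)))"
      then have "m + inverse (real (Suc n)) \<le> m"
        unfolding m_def using assms by (intro cInf_greatest) (auto simp: not_less)
      then show False by (simp del: of_nat_Suc)
    qed
    then show ?thesis unfolding F_def by (blast intro: less_imp_le)
  qed
  moreover have "F n \<subseteq> F k" if "k \<le> n" for k n
  proof -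
    have "inverse (real (Suc n)) \<le> inverse (real (Suc k))" using that by (intro le_imp_inverse_le) auto
    then have "m + inverse (real (Suc n)) \<le> m + inverse (real (Suc k))" by simp
    then show ?thesis unfolding F_def by (blast intro: order_trans)
  qed
  ultimately have "\<Inter>(range F) \<noteq> {}" by (rule compact_nest)
  then obtain x where x: "\<And>n. x \<in> F n" by auto
  then have le: "q x \<le> m + inverse (real (Suc n))" and xJ: "x \<in> {u..v}" for n
    unfolding F_def by blast+
  have "q x \<le> m + 0"
    by (rule LIMSEQ_le_const[OF tendsto_add[OF tendsto_const LIMSEQ_inverse_real_of_nat]])
       (use le in blast)
  moreover have "m \<le> q y" if "y \<in> {u..v}" for y
    unfolding m_def using bdd that by (rule cINF_lower)
  ultimately have "q x \<le> q y" if "y \<in> {u..v}" for y using that by fastforce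
  then show ?thesis using xJ by (rule that[rotated])
qed

text \<open>On the minimum set of \<open>q\<close> every branch with non-vanishing mask stays in the set. Following
  the branch of the digit 0, the mask must vanish somewhere (otherwise \<open>q 0\<close> would be too small), so
  the set is finite. Since an interval of length less than 1 contains at most one \<open>b * y - c\<close>,
  the successor map is injective on it, hence bijective, and the mask has modulus 1 there.\<close>

lemma q_eq_1_near_attractor:
  assumes s: "s > 0" "top_pt + 2 * s < 1" and x: "x \<in> {- s..top_pt + s}"
  shows "q x = 1"
proof (rule ccontr)
  assume "q x \<noteq> 1"
  define J where "J = {- s..top_pt + s}"
  obtain x0 where x0: "x0 \<in> J" "\<And>y. y \<in> J \<Longrightarrow> q x0 \<le> q y"
    using q_attains_min[OF x] unfolding J_def by blast
  define m where "m = q x0"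
  have "m < 1" using x0(2)[of x] x q_le_1[of x] \<open>q x \<noteq> 1\<close> by (simp add: m_def J_def)
  define M where "M = {y \<in> J. q y = m}"
  have b1: "real_of_int b > 1" using b_gt_2 by simp
  have "s / of_int b \<le> s" using s b1 by (simp add: field_simps)
  then have J_step: "(y + of_int c) / of_int b \<in> J" if "y \<in> J" "c \<in> C" for y c
    using preimage_bounds[OF that(2), of s y] that(1) by (simp add: J_def)
  have J_1: "J \<subseteq> {-1..1}" using s top_pt by (auto simp: J_def)
  have J_inj: "y = z" if "y \<in> J" "z \<in> J" "y - z \<in> \<int>" for y z
  proof -
    obtain k where k: "y - z = of_int k" using \<open>y - z \<in> \<int>\<close> by (auto elim: Ints_cases)
    have "\<bar>y - z\<bar> < 1" using that(1,2) s top_pt by (auto simp: J_def)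
    then have "k = 0" unfolding k by linarith
    then show ?thesis using k by simp
  qed
  have M_step: "(y + of_int c) / of_int b \<in> M"
    if y: "y \<in> M" and c: "c \<in> C" and nz: "mask ((y + of_int c) / of_int b) \<noteq> 0" for y c
  proof -
    let ?w = "\<lambda>c. (cmod (mask ((y + of_int c) / of_int b)))\<^sup>2"
    let ?q = "\<lambda>c. q ((y + of_int c) / of_int b)"
    have yJ: "y \<in> J" "q y = m" using y by (auto simp: M_def)
    have ge: "m \<le> ?q c" if "c \<in> C" for c using x0(2)[OF J_step[OF yJ(1) that]] by (simp add: m_def)
    \<comment> \<open>By \<open>q_rec\<close> the minimum m is a weighted average of values that are
      at least m, so every value with positive weight equals m.\<close>
    have "(\<Sum>c\<in>C. ?w c * (?q c - m)) = (\<Sum>c\<in>C. ?w c * ?q c) - (\<Sum>c\<in>C. ?w c) * m"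
      by (simp only: right_diff_distrib sum_subtractf sum_distrib_right)
    also have "\<dots> = 0" using q_rec[of y] yJ(2) by (simp only: sum_mask_square)
    finally have "(\<Sum>c\<in>C. ?w c * (?q c - m)) = 0" .
    then have "\<forall>c\<in>C. ?w c * (?q c - m) = 0"
      using ge by (subst (asm) sum_nonneg_eq_0_iff[OF fin_C]) auto
    then have "?q c = m" using c nz by auto
    then show ?thesis using J_step[OF yJ(1) c] by (simp add: M_def)
  qed
  have zero_notin: "0 \<notin> M" using \<open>m < 1\<close> by (simp add: M_def q_0)
  have vanish: "\<exists>j. mask (y / of_int b ^ j) = 0" if y: "y \<in> M" for y
  proof (rule ccontr)
    assume nz: "\<not> (\<exists>j. mask (y / of_int b ^ j) = 0)"
    have "y / of_int b ^ j \<in> M" for j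
    proof (induction j)
      case 0
      then show ?case using y by simp
    next
      case (Suc j)
      have e: "(y / of_int b ^ j + of_int 0) / of_int b = y / of_int b ^ Suc j" by (simp add: mult.commute)
      show ?case using M_step[OF Suc zero_C] nz unfolding e by blast
    qed
    then have le: "Q 0 (y / of_int b ^ j) \<le> m" for j
      using Q_le_q[of 0 "y / of_int b ^ j"] by (simp add: M_def)
    have "(\<lambda>j. y * inverse (real_of_int b) ^ j) \<longlonglongrightarrow> y * 0"
      using b1 by (intro tendsto_intros LIMSEQ_power_zero) (simp add: inverse_less_1_iff)
    then have "(\<lambda>j. y / of_int b ^ j) \<longlonglongrightarrow> 0" by (simp add: power_inverse divide_inverse)
    moreover have "isCont (Q 0) 0" using continuous_Q by (simp add: continuous_on_eq_continuous_at)
    ultimately have "(\<lambda>j. Q 0 (y / of_int b ^ j)) \<longlonglongrightarrow> Q 0 0" by (rule isCont_tendsto_compose[rotated])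
    then have "Q 0 0 \<le> m" by (rule LIMSEQ_le_const2) (use le in blast)
    then show False using \<open>m < 1\<close> by (simp add: Q_def ft_0)
  qed
  have "finite M"
  proof -
    \<comment> \<open>The mask has no zero within e of 0, so only the finitely many scales j < N can
      produce the zero supplied by \<open>vanish\<close>, and each contributes a finite set.\<close>
    obtain e where e: "e > 0" "\<And>z. \<bar>z\<bar> < e \<Longrightarrow> mask z \<noteq> 0"
      using continuous_at_avoid[OF continuous_mask, of 0 0] mask_0 by (auto simp: dist_real_def)
    obtain N where N: "1 / real_of_int b ^ N < e"
      using real_arch_pow_inv[of e "inverse (of_int b)"] e(1) b1
      by (auto simp: inverse_less_1_iff power_inverse divide_inverse)
    have "M \<subseteq> (\<Union>j<N. (\<lambda>z. z * of_int b ^ j) ` {z \<in> {-1..1}. mask z = 0})"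
    proof
      fix y assume y: "y \<in> M"
      then obtain j where j: "mask (y / of_int b ^ j) = 0" using vanish by blast
      have y1: "\<bar>y\<bar> \<le> 1" using y J_1 by (force simp: M_def)
      have bj: "real_of_int b ^ j \<ge> 1" using b1 by simp
      have le: "\<bar>y / of_int b ^ j\<bar> \<le> 1 / of_int b ^ j"
        using y1 bj by (simp add: divide_right_mono)
      have "j < N"
      proof (rule ccontr)
        assume "\<not> j < N"
        then have "real_of_int b ^ N \<le> of_int b ^ j" using b1 by (intro power_increasing) auto
        then have "1 / real_of_int b ^ j \<le> 1 / of_int b ^ N" using b1 by (intro divide_left_mono) auto
        then show False using le N e(2) j by force
      qed
      moreover have "\<bar>y / of_int b ^ j\<bar> \<le> 1"
        using le bj by (meson order_trans divide_le_eq_1_pos zero_less_one less_le_trans)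
      then have "y / of_int b ^ j \<in> {z \<in> {-1..1}. mask z = 0}"
        using j unfolding abs_le_iff by auto
      moreover have "y = y / of_int b ^ j * of_int b ^ j" using b1 by simp
      ultimately show "y \<in> (\<Union>j<N. (\<lambda>z. z * of_int b ^ j) ` {z \<in> {-1..1}. mask z = 0})" by blast
    qed
    then show ?thesis using finite_mask_zeros by (auto intro: finite_subset)
  qed
  have "\<exists>c\<in>C. mask ((y + of_int c) / of_int b) \<noteq> 0" for y
  proof (rule ccontr)
    assume "\<not> ?thesis"
    then have "(\<Sum>c\<in>C. (cmod (mask ((y + of_int c) / of_int b)))\<^sup>2) = 0" by simp
    then show False by (simp only: sum_mask_square)
  qed
  then obtain d where d: "\<And>y. d y \<in> C" "\<And>y. mask ((y + of_int (d y)) / of_int b) \<noteq> 0"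
    by metis
  define f where "f y = (y + of_int (d y)) / of_int b" for y
  have fM: "f ` M \<subseteq> M" using M_step d by (auto simp: f_def)
  have pred: "y = z" if "y \<in> M" "z \<in> M" "(y + of_int c) / of_int b = (z + of_int c') / of_int b" for y z c c'
  proof (rule J_inj)
    have "y - z = of_int (c' - c)" using that(3) b1 by simp
    then show "y - z \<in> \<int>" by simp
  qed (use that in \<open>auto simp: M_def\<close>)
  have "inj_on f M" unfolding inj_on_def f_def using pred by blast
  then have fM_eq: "f ` M = M" using \<open>finite M\<close> fM by (intro endo_inj_surj)
  have x0M: "x0 \<in> M" using x0 by (simp add: M_def m_def)
  \<comment> \<open>A second branch with nonzero mask would also end in \<open>M\<close>, which is
    the image of f; by \<open>pred\<close> its target has no predecessor in \<open>M\<close> other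
    than x0, so the digit would be \<open>d x0\<close> after all.\<close>
  have others: "mask ((x0 + of_int c) / of_int b) = 0" if c: "c \<in> C" "c \<noteq> d x0" for c
  proof (rule ccontr)
    assume "mask ((x0 + of_int c) / of_int b) \<noteq> 0"
    then have "(x0 + of_int c) / of_int b \<in> M" using M_step x0M c by blast
    then have "(x0 + of_int c) / of_int b \<in> f ` M" by (simp only: fM_eq)
    then obtain z where z: "z \<in> M" "(x0 + of_int c) / of_int b = (z + of_int (d z)) / of_int b"
      unfolding f_def by blast
    then have "x0 = z" using pred x0M by blast
    then show False using z(2) b1 c(2) by simp
  qed
  have "(\<Sum>c\<in>C. (cmod (mask ((x0 + of_int c) / of_int b)))\<^sup>2)
    = (cmod (mask (f x0)))\<^sup>2 + (\<Sum>c\<in>C - {d x0}. (cmod (mask ((x0 + of_int c) / of_int b)))\<^sup>2)"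
    unfolding f_def by (rule sum.remove[OF fin_C d(1)])
  also have "(\<Sum>c\<in>C - {d x0}. (cmod (mask ((x0 + of_int c) / of_int b)))\<^sup>2) = 0"
    using others by (intro sum.neutral) auto
  finally have "(cmod (mask (f x0)))\<^sup>2 = 1" by (simp only: sum_mask_square)
  then have "cmod (mask (f x0)) = 1" by (simp add: power2_eq_1_iff) (use norm_ge_zero[of "mask (f x0)"] in linarith)
  then have "f x0 \<in> \<int>" by (rule norm_mask_1_imp_int)
  moreover have "f x0 \<in> J" using fM x0M by (auto simp: M_def)
  moreover have "0 \<in> J" using s top_pt by (simp add: J_def)
  ultimately have "f x0 = 0" using J_inj[of "f x0" 0] by simp
  then show False using fM x0M zero_notin by force
qed

text \<open>The recursion spreads the value 1 from a neighbourhood of the attractor: a point with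
  excess at most s * b^k has all branches within excess s * b^(k-1). Any positive s with 2 * s below
  the gap 1 - \<open>top_pt\<close> would start the induction.\<close>

lemma q_eq_1: "q x = 1"
proof -
  define s where "s = (1 - top_pt) / 4"
  have s: "s > 0" "top_pt + 2 * s < 1" using top_pt(2) by (simp_all add: s_def field_simps)
  have b1: "real_of_int b > 1" using b_gt_2 by simp
  have "q x = 1" if "- (s * of_int b ^ k) \<le> x" "x \<le> top_pt + s * of_int b ^ k" for k x
    using that
  proof (induction k arbitrary: x)
    case 0
    then show ?case using q_eq_1_near_attractor[OF s, of x] by simp
  next
    case (Suc k)
    have e: "s * of_int b ^ Suc k / of_int b = s * of_int b ^ k" using b1 by simp
    have "q ((x + of_int c) / of_int b) = 1" if "c \<in> C" for c
      using preimage_bounds[OF that Suc.prems] unfolding e by (rule Suc.IH)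
    then have "q x = (\<Sum>c\<in>C. (cmod (mask ((x + of_int c) / of_int b)))\<^sup>2)"
      by (subst q_rec) simp
    then show ?case by (simp only: sum_mask_square)
  qed
  moreover obtain k where k: "\<bar>x\<bar> / s < of_int b ^ k" using real_arch_pow[OF b1] by blast
  have "\<bar>x\<bar> \<le> s * of_int b ^ k" using k s(1) by (simp add: field_simps)
  then have "- (s * of_int b ^ k) \<le> x" "x \<le> top_pt + s * of_int b ^ k" using top_pt(1) by auto
  ultimately show ?thesis by blast
qed

section \<open>Spectra in terms of zeros of \<open>ft\<close> and closed spans\<close>

definition chi_span :: "real set \<Rightarrow> (real \<Rightarrow> complex) set" where
  "chi_span \<Lambda> = {(\<lambda>x. \<Sum>l\<in>F. a l * chi l x) | F a. finite F \<and> F \<subseteq> \<Lambda>}"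

lemma chi_L2: "chi l \<in> L2_space \<mu>"
  by (rule \<mu>.L2_space_bounded[where B=1]) auto

lemma L2_subspace_chi_span: "L2_subspace \<mu> (chi_span \<Lambda>)"
proof
  show "chi_span \<Lambda> \<subseteq> L2_space \<mu>"
  proof
    fix f assume "f \<in> chi_span \<Lambda>"
    then obtain F a where f: "finite F" "f = (\<lambda>x. \<Sum>l\<in>F. a l * chi l x)" by (auto simp: chi_span_def)
    have "cmod (f x) \<le> (\<Sum>l\<in>F. cmod (a l))" for x
      unfolding f by (rule order_trans[OF norm_sum]) (simp add: norm_mult)
    then show "f \<in> L2_space \<mu>"
      by (intro \<mu>.L2_space_bounded[where B="\<Sum>l\<in>F. cmod (a l)"]) (auto simp: f(2))
  qed
  show "(\<lambda>x. 0) \<in> chi_span \<Lambda>"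
    by (auto simp: chi_span_def intro!: exI[of _ "{}"])
  fix f assume "f \<in> chi_span \<Lambda>"
  then obtain F a where f: "finite F" "F \<subseteq> \<Lambda>" "f = (\<lambda>x. \<Sum>l\<in>F. a l * chi l x)"
    by (auto simp: chi_span_def)
  show "(\<lambda>x. c * f x) \<in> chi_span \<Lambda>" for c
    using f by (auto simp: chi_span_def sum_distrib_left mult.assoc
        intro!: exI[of _ F] exI[of _ "\<lambda>l. c * a l"])
  fix g assume "g \<in> chi_span \<Lambda>"
  then obtain G e where g: "finite G" "G \<subseteq> \<Lambda>" "g = (\<lambda>x. \<Sum>l\<in>G. e l * chi l x)"
    by (auto simp: chi_span_def)
  \<comment> \<open>Both coefficient families are extended by 0, so that they add up where
    \<open>F\<close> and \<open>G\<close> overlap.\<close>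
  define h where "h l = (if l \<in> F then a l else 0) + (if l \<in> G then e l else 0)" for l
  have "f x + g x = (\<Sum>l\<in>F \<union> G. h l * chi l x)" for x
  proof -
    have "f x = (\<Sum>l\<in>F \<union> G. (if l \<in> F then a l else 0) * chi l x)"
      unfolding f(3) using f(1) g(1) by (intro sum.mono_neutral_cong_left) auto
    moreover have "g x = (\<Sum>l\<in>F \<union> G. (if l \<in> G then e l else 0) * chi l x)"
      unfolding g(3) using f(1) g(1) by (intro sum.mono_neutral_cong_left) auto
    ultimately show ?thesis by (simp only: h_def distrib_right sum.distrib)
  qed
  then show "(\<lambda>x. f x + g x) \<in> chi_span \<Lambda>"
    unfolding chi_span_def using f g by blast
qed

text \<open>Normalization is automatic because \<open>ft 0 = 1\<close>. Passing between \<epsilon>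
  and its square identifies density in norm with membership in \<open>cl\<close>.\<close>

lemma is_spectrum_iff:
  "is_spectrum \<mu> \<Lambda> \<longleftrightarrow> countable \<Lambda> \<and>
    (\<forall>l\<in>\<Lambda>. \<forall>l'\<in>\<Lambda>. l \<noteq> l' \<longrightarrow> ft (l' - l) = 0) \<and> L2_space \<mu> \<subseteq> L2_subspace.cl \<mu> (chi_span \<Lambda>)"
proof -
  interpret L2_subspace \<mu> "chi_span \<Lambda>" by (rule L2_subspace_chi_span)
  have chi: "(\<lambda>l x. exp (- (2 * of_real pi * \<i> * of_real l * of_real x))) = chi"
    by (intro ext) (simp add: chi_def)
  have "(\<forall>f\<in>L2_space \<mu>. \<forall>\<epsilon>>0. \<exists>F a. finite F \<and> F \<subseteq> \<Lambda> \<and>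
      L2_norm \<mu> (\<lambda>x. f x - (\<Sum>l\<in>F. a l * chi l x)) < \<epsilon>) \<longleftrightarrow> L2_space \<mu> \<subseteq> cl" (is "?L \<longleftrightarrow> ?R")
  proof
    assume ?L
    show ?R
    proof
      fix f assume f: "f \<in> L2_space \<mu>"
      show "f \<in> cl"
        unfolding cl_def
      proof (intro CollectI conjI f allI impI)
        fix \<epsilon> :: real assume "\<epsilon> > 0"
        then have "sqrt \<epsilon> > 0" by simp
        from \<open>?L\<close>[rule_format, OF f this] obtain F a where F: "finite F" "F \<subseteq> \<Lambda>"
          and "L2_norm \<mu> (\<lambda>x. f x - (\<Sum>l\<in>F. a l * chi l x)) < sqrt \<epsilon>"
          by blast
        then have "(LINT x|\<mu>. (cmod (f x - (\<Sum>l\<in>F. a l * chi l x)))\<^sup>2) < \<epsilon>"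
          using \<open>\<epsilon> > 0\<close> by (simp add: L2_norm_less_iff)
        moreover have "(\<lambda>x. \<Sum>l\<in>F. a l * chi l x) \<in> chi_span \<Lambda>"
          using F unfolding chi_span_def by blast
        ultimately show "\<exists>g\<in>chi_span \<Lambda>. (LINT x|\<mu>. (cmod (f x - g x))\<^sup>2) < \<epsilon>"
          by (intro bexI)
      qed
    qed
  next
    assume ?R
    show ?L
    proof (intro ballI allI impI)
      fix f and \<epsilon> :: real assume "f \<in> L2_space \<mu>" and e: "\<epsilon> > 0"
      then have "f \<in> cl" using \<open>?R\<close> by blast
      then obtain g where "g \<in> chi_span \<Lambda>" "(LINT x|\<mu>. (cmod (f x - g x))\<^sup>2) < \<epsilon>\<^sup>2"
        by (rule clD[of f "\<epsilon>\<^sup>2"]) (use e in auto)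
      then obtain F a where "finite F" "F \<subseteq> \<Lambda>"
        "(LINT x|\<mu>. (cmod (f x - (\<Sum>l\<in>F. a l * chi l x)))\<^sup>2) < \<epsilon>\<^sup>2"
        unfolding chi_span_def by blast
      then show "\<exists>F a. finite F \<and> F \<subseteq> \<Lambda> \<and> L2_norm \<mu> (\<lambda>x. f x - (\<Sum>l\<in>F. a l * chi l x)) < \<epsilon>"
        unfolding L2_norm_less_iff[OF e] by blast
    qed
  qed
  moreover have "L2_inner \<mu> (chi l) (chi l') = (if l = l' then 1 else 0)
    \<longleftrightarrow> (l \<noteq> l' \<longrightarrow> ft (l' - l) = 0)" for l l'
    by (simp add: L2_inner_chi ft_0)
  ultimately show ?thesis
    unfolding is_spectrum_def L2_orthonormal_basis_def chi by (simp add: chi_L2)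
qed

lemma is_spectrum_canonical: "is_spectrum \<mu> (of_int ` canonical_spectrum b C)"
proof -
  let ?\<Lambda> = "real_of_int ` canonical_spectrum b C"
  interpret L2_subspace \<mu> "chi_span ?\<Lambda>" by (rule L2_subspace_chi_span)
  have orth: "ft (l - l') = 0" if "l \<in> ?\<Lambda>" "l' \<in> ?\<Lambda>" "l \<noteq> l'" for l l'
    using that ft_spectrum_orthogonal by auto
  have "chi y \<in> cl" for y
  proof (rule cl_limit[OF chi_L2])
    \<comment> \<open>The orthogonal projection of \<open>chi y\<close>: by
      \<open>L2_inner_chi\<close> the coefficient at l is \<open>ft (l - y)\<close>. Its squared
      distance from \<open>chi y\<close> is 1 - \<open>Q k (- y)\<close>, which tends to 0 by
      \<open>q_eq_1\<close>.\<close>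
    define P where "P k x = (\<Sum>l\<in>of_int ` Lam k. ft (l - y) * chi l x)" for k x
    have Lam_sub: "real_of_int ` Lam k \<subseteq> ?\<Lambda>" for k by (auto simp: canonical_spectrum_eq)
    have P: "P k \<in> chi_span ?\<Lambda>" for k
      unfolding chi_span_def
      by (intro CollectI exI[of _ "of_int ` Lam k"] exI[of _ "\<lambda>l. ft (l - y)"] conjI Lam_sub)
         (simp_all add: P_def finite_Lam fun_eq_iff)
    show "P k \<in> cl" for k
      unfolding cl_def using P[of k] subsetD[OF sub P[of k]] by (auto intro!: bexI[of _ "P k"])
    have "(LINT x|\<mu>. (cmod (chi y x - P k x))\<^sup>2) = 1 - Q k (- y)" for k
    proof -
      have "(LINT x|\<mu>. (cmod (chi y x - P k x))\<^sup>2)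
        = 1 - 2 * Re (\<Sum>l\<in>of_int ` Lam k. cnj (ft (l - y)) * ft (l - y))
          + (\<Sum>l\<in>of_int ` Lam k. (cmod (ft (l - y)))\<^sup>2)"
        unfolding P_def by (rule chi_dist) (use finite_Lam Lam_sub orth in \<open>auto simp: subset_iff\<close>)
      also have "Re (\<Sum>l\<in>of_int ` Lam k. cnj (ft (l - y)) * ft (l - y))
        = (\<Sum>l\<in>of_int ` Lam k. (cmod (ft (l - y)))\<^sup>2)"
        by (simp only: Re_sum) (intro sum.cong refl, simp add: cmod_power2, simp add: power2_eq_square)
      also have "(\<Sum>l\<in>of_int ` Lam k. (cmod (ft (l - y)))\<^sup>2) = Q k (- y)"
        unfolding Q_def by (subst sum.reindex) (auto simp: inj_on_def)
      finally show ?thesis by simp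
    qed
    then show "(\<lambda>k. LINT x|\<mu>. (cmod (chi y x - P k x))\<^sup>2) \<longlonglongrightarrow> 0"
      using tendsto_diff[OF tendsto_const[of 1] Q_tendsto[of "- y"]] by (simp add: q_eq_1)
  qed
  then interpret L2_subspace_chi \<mu> "chi_span ?\<Lambda>" by unfold_locales auto
  show ?thesis
    unfolding is_spectrum_iff using L2_space_subset_cl orth by auto
qed

lemma spectral_eigenvalue_1: "spectral_eigenvalue b D C 1"
  using is_spectrum_canonical by (simp add: spectral_eigenvalue_def)

end

section \<open>Repunits\<close>

definition repunit :: "int \<Rightarrow> nat \<Rightarrow> int" where
  "repunit b n = (\<Sum>i<n. b ^ i)"

lemma repunit_0 [simp]: "repunit b 0 = 0"
  by (simp add: repunit_def)

lemma repunit_Suc: "repunit b (Suc n) = 1 + b * repunit b n"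
  unfolding repunit_def sum.lessThan_Suc_shift by (simp add: sum_distrib_left)

lemma repunit_add: "repunit b (m + n) = repunit b m + b ^ m * repunit b n"
  by (induction m) (auto simp: repunit_Suc algebra_simps)

lemma repunit_mult: "(b - 1) * repunit b n = b ^ n - 1"
  by (induction n) (auto simp: repunit_Suc algebra_simps)

lemma repunit_pos: "b > 0 \<Longrightarrow> n > 0 \<Longrightarrow> repunit b n > 0"
  unfolding repunit_def by (intro sum_pos) auto

lemma repunit_dvd: "repunit b n dvd repunit b (n * k)"
  by (induction k) (auto simp: repunit_add)

text \<open>Euclid's algorithm on the lengths: s divides the block whose length is the largest
  multiple of n below m, and hence also the remaining \<open>repunit b (m mod n)\<close>.\<close>

lemma dvd_repunit_gcd: "s dvd repunit b m \<Longrightarrow> s dvd repunit b n \<Longrightarrow> s dvd repunit b (gcd m n)"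
proof (induction m n rule: gcd_nat_induct)
  case (step m n)
  have "repunit b m = repunit b (m mod n) + b ^ (m mod n) * repunit b (n * (m div n))"
    by (simp flip: repunit_add)
  then have "s dvd repunit b (m mod n)"
    using step.prems dvd_trans[OF step.prems(2) repunit_dvd[of b n "m div n"]]
    by (metis dvd_add_left_iff dvd_mult)
  then show ?case using step by (simp add: gcd_red_nat[of m n])
qed simp

section \<open>Non-spectral repunits and their primitive divisors\<close>

context canonical_triple begin

lemma repunit_Lam: "c \<in> C \<Longrightarrow> c * repunit b n \<in> Lam n"
proof (induction n)
  case (Suc n)
  have "c * repunit b (Suc n) = c + b * (c * repunit b n)" by (simp add: repunit_Suc algebra_simps)
  then show ?case using Suc by (auto intro!: image_eqI[of _ _ "(c, c * repunit b n)"])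
qed simp

text \<open>The repunit with \<open>b - 1\<close> ones is divisible by \<open>b - 1\<close>, so a nonzero digit \<open>c\<close> repeated \<open>b - 1\<close>
  times gives a nonzero integer \<open>x\<close> with \<open>(b ^ n - 1) * x = t * l0\<close>, \<open>l0 \<in> Lam n\<close>. Thus \<open>- x\<close> lies
  in the \<open>b\<close>-adic closure of \<open>t\<close> times the spectrum, and \<open>chi (- x)\<close> is orthogonal to it.\<close>

lemma ex_orthogonal_character:
  assumes n: "int n \<ge> b - 1"
  shows "\<exists>x :: int. \<forall>l\<in>canonical_spectrum b C. ft (of_int (repunit b n * l + x)) = 0"
proof -
  define t where "t = repunit b n"
  define j where "j = nat (b - 1)"
  obtain c where c: "c \<in> C" "c > 0" using ex_nonzero_C by auto
  have jn: "j \<le> n" "0 < j" "int j = b - 1" using n b_gt_2 by (auto simp: j_def)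
  define l0 where "l0 = c * repunit b j"
  \<comment> \<open>Here n >= b - 1 enters: the block of b - 1 equal digits fits into n places after
    padding with the digit 0.\<close>
  have l0: "l0 \<in> Lam n" using repunit_Lam[OF c(1)] Lam_mono[OF jn(1)] by (auto simp: l0_def)
  have "l0 > 0" using repunit_pos[of b j] c(2) jn b_gt_2 by (simp add: l0_def)
  \<comment> \<open>Every power of b is 1 modulo b - 1, so a repunit is congruent to its number of
    ones.\<close>
  have "b - 1 dvd repunit b i - int i" for i
  proof (induction i)
    case (Suc i)
    have "repunit b (Suc i) - int (Suc i) = (b - 1) * repunit b i + (repunit b i - int i)"
      by (simp add: repunit_Suc algebra_simps)
    then show ?case using Suc by (simp only: dvd_add dvd_triv_left)
  qed simp
  then have "b - 1 dvd repunit b j" using jn(3) by (metis dvd_diff_commute dvd_diff_right_iff dvd_refl)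
  then obtain u where u: "repunit b j = (b - 1) * u" by blast
  define x where "x = c * u"
  have l0x: "l0 = (b - 1) * x" by (simp add: l0_def u x_def)
  have t: "(b - 1) * t = b ^ n - 1" by (simp add: t_def repunit_mult)
  have x: "- x = t * l0 - b ^ n * x"
  proof -
    have "t * l0 = ((b - 1) * t) * x" by (simp add: l0x)
    then show ?thesis unfolding t by (simp add: algebra_simps)
  qed
  have "n > 0" using jn by simp
  then have "t mod b = 1"
    using b_gt_2 by (cases n) (auto simp: t_def repunit_Suc)
  \<comment> \<open>Repeating the block of l0 k times gives the b-adic approximations. The bound
    \<open>int k \<le> m\<close> makes m leave every fixed element l behind, as
    \<open>ft_zero\<close> needs distinct digit strings.\<close>
  have approx: "\<exists>m\<in>Lam (k * n). int k \<le> m \<and> - x = t * m - b ^ (k * n) * x" for k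
  proof (induction k)
    case 0
    then show ?case by simp
  next
    case (Suc k)
    then obtain m where m: "m \<in> Lam (k * n)" "int k \<le> m" "- x = t * m - b ^ (k * n) * x" by blast
    have "b ^ n * m \<ge> 1 * m" using m b_gt_2 by (intro mult_right_mono) auto
    then have "int (Suc k) \<le> l0 + b ^ n * m" using m(2) \<open>l0 > 0\<close> by simp
    moreover have "l0 + b ^ n * m \<in> Lam (Suc k * n)" using Lam_append[OF l0 m(1)] by simp
    moreover have "- x = t * (l0 + b ^ n * m) - b ^ (Suc k * n) * x"
    proof -
      have "- x = t * l0 + b ^ n * (- x)" unfolding mult_minus_right using x by linarith
      also have "\<dots> = t * l0 + b ^ n * (t * m - b ^ (k * n) * x)" by (subst m(3)) (rule refl)
      also have "\<dots> = t * (l0 + b ^ n * m) - b ^ (Suc k * n) * x"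
        by (simp add: algebra_simps power_add)
      finally show ?thesis .
    qed
    ultimately show ?case by blast
  qed
  have "ft (of_int (t * l + x)) = 0" if l: "l \<in> canonical_spectrum b C" for l
  proof -
    obtain i where i: "l \<in> Lam i" using l by (auto simp: canonical_spectrum_eq)
    \<comment> \<open>Large enough for l to be written with \<open>k * n\<close> digits, and for m >
      l.\<close>
    define k where "k = max i (nat l + 1)"
    obtain m where m: "m \<in> Lam (k * n)" "int k \<le> m" "- x = t * m - b ^ (k * n) * x" using approx by blast
    have "i \<le> k" by (simp add: k_def)
    also have "k \<le> k * n" using \<open>n > 0\<close> by simp
    finally have "i \<le> k * n" .
    then have "l \<in> Lam (k * n)" using i Lam_mono by blast
    moreover have "m \<noteq> l" using m(2) by (auto simp: k_def)
    ultimately have "ft (of_int (t * (m - l) + b ^ (k * n) * (- x))) = 0"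
      using ft_zero[OF \<open>t mod b = 1\<close> m(1)] by blast
    moreover have "t * (m - l) + b ^ (k * n) * (- x) = - (t * l + x)"
      using m(3) by (simp add: algebra_simps)
    ultimately have "ft (- of_int (t * l + x)) = 0" by (simp only: of_int_minus)
    then have "cnj (ft (of_int (t * l + x))) = 0" by (simp only: cnj_ft)
    then show ?thesis by simp
  qed
  then show ?thesis unfolding t_def by blast
qed

text \<open>A unit vector orthogonal to the whole family has squared distance at least 1 from every
  finite combination, so it cannot lie in the closed span.\<close>

lemma not_spectral_repunit:
  assumes "int n \<ge> b - 1"
  shows "\<not> spectral_eigenvalue b D C (nat (repunit b n))"
proof
  assume spec: "spectral_eigenvalue b D C (nat (repunit b n))"
  define \<Lambda> where "\<Lambda> = (\<lambda>l. real (nat (repunit b n)) * real_of_int l) ` canonical_spectrum b C"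
  interpret L2_subspace \<mu> "chi_span \<Lambda>" by (rule L2_subspace_chi_span)
  obtain x :: int where x: "\<forall>l\<in>canonical_spectrum b C. ft (of_int (repunit b n * l + x)) = 0"
    using ex_orthogonal_character[OF assms] by blast
  have "repunit b n > 0" using repunit_pos assms b_gt_2 by simp
  then have x': "ft (l - of_int (- x)) = 0" if "l \<in> \<Lambda>" for l using x that by (auto simp: \<Lambda>_def)
  have "chi (of_int (- x)) \<in> cl" and orth: "\<And>l l'. l \<in> \<Lambda> \<Longrightarrow> l' \<in> \<Lambda> \<Longrightarrow> l \<noteq> l' \<Longrightarrow> ft (l - l') = 0"
    using spec chi_L2 unfolding spectral_eigenvalue_def \<Lambda>_def[symmetric] is_spectrum_iff
    by (auto dest: subsetD)
  then obtain g where "g \<in> chi_span \<Lambda>" "(LINT y|\<mu>. (cmod (chi (of_int (- x)) y - g y))\<^sup>2) < 1"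
    by (elim clD[where \<epsilon>=1]) auto
  then obtain F a where F: "finite F" "F \<subseteq> \<Lambda>"
    "(LINT y|\<mu>. (cmod (chi (of_int (- x)) y - (\<Sum>l\<in>F. a l * chi l y)))\<^sup>2) < 1"
    unfolding chi_span_def by blast
  have "(LINT y|\<mu>. (cmod (chi (of_int (- x)) y - (\<Sum>l\<in>F. a l * chi l y)))\<^sup>2)
    = 1 - 2 * Re (\<Sum>l\<in>F. cnj (a l) * ft (l - of_int (- x))) + (\<Sum>l\<in>F. (cmod (a l))\<^sup>2)"
    using F orth by (intro chi_dist) auto
  also have "(\<Sum>l\<in>F. cnj (a l) * ft (l - of_int (- x))) = 0"
    using x' F(2) by (intro sum.neutral) (simp add: subset_iff)
  finally show False using F(3) sum_nonneg[of F "\<lambda>l. (cmod (a l))\<^sup>2"] by simp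
qed

lemma ex_primitive_divisor:
  assumes "t \<ge> 1" "\<not> spectral_eigenvalue b D C t"
  shows "\<exists>s. s dvd t \<and> primitively_nonspectral_eigenvalue b D C s"
proof -
  define P where "P s \<longleftrightarrow> s dvd t \<and> \<not> spectral_eigenvalue b D C s" for s
  \<comment> \<open>Minimality in size suffices: a proper divisor of s is smaller than s and still
    divides t.\<close>
  define s where "s = (LEAST s. P s)"
  have "P t" using assms by (simp add: P_def)
  then have s: "P s" unfolding s_def by (rule LeastI)
  then have "s dvd t" by (simp add: P_def)
  then have s1: "s \<ge> 1" using assms(1) by (cases s) auto
  have "spectral_eigenvalue b D C t'" if "t' dvd s" "t' \<noteq> s" for t'
  proof (rule ccontr)
    assume "\<not> spectral_eigenvalue b D C t'"
    then have "P t'" using s that by (auto simp: P_def intro: dvd_trans)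
    then have "s \<le> t'" unfolding s_def by (rule Least_le)
    then show False using dvd_imp_le[OF that(1)] that(2) s1 by simp
  qed
  then show ?thesis
    using s s1 by (auto simp: primitively_nonspectral_eigenvalue_def P_def)
qed

lemma infinite_primitively_nonspectral:
  "infinite {t. primitively_nonspectral_eigenvalue b D C t}"
proof -
  \<comment> \<open>Discarding the primes up to b ensures the length condition of
    \<open>not_spectral_repunit\<close>.\<close>
  define A where "A = {p :: nat. prime p} - {..nat b}"
  have "infinite A" unfolding A_def using primes_infinite by (rule Diff_infinite_finite[rotated]) simp
  have "\<exists>s. int s dvd repunit b p \<and> primitively_nonspectral_eigenvalue b D C s" if "p \<in> A" for p
  proof -
    have p: "int p \<ge> b - 1" "p > 0" using that b_gt_2 by (auto simp: A_def)
    then have pos: "repunit b p > 0" using repunit_pos b_gt_2 by simp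
    then have "nat (repunit b p) \<ge> 1" by linarith
    from ex_primitive_divisor[OF this not_spectral_repunit[OF p(1)]]
    obtain s where s: "s dvd nat (repunit b p)" "primitively_nonspectral_eigenvalue b D C s"
      by blast
    have "int s dvd int (nat (repunit b p))" using s(1) by (simp only: int_dvd_int_iff)
    then have "int s dvd repunit b p" using pos by simp
    then show ?thesis using s(2) by blast
  qed
  then obtain f where f: "\<And>p. p \<in> A \<Longrightarrow> int (f p) dvd repunit b p"
    "\<And>p. p \<in> A \<Longrightarrow> primitively_nonspectral_eigenvalue b D C (f p)" by metis
  have "inj_on f A"
  proof (rule inj_onI, rule ccontr)
    fix p r assume pr: "p \<in> A" "r \<in> A" "f p = f r" "p \<noteq> r"
    then have "coprime p r" by (auto simp: A_def intro: primes_coprime)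
    then have "int (f p) dvd repunit b 1"
      using dvd_repunit_gcd[of "int (f p)" b p r] f(1)[OF pr(1)] f(1)[OF pr(2)] pr(3) by simp
    then have "f p = 1" by (simp add: repunit_def)
    then show False
      using f(2)[OF pr(1)] spectral_eigenvalue_1 by (simp add: primitively_nonspectral_eigenvalue_def)
  qed
  then have "infinite (f ` A)" using \<open>infinite A\<close> finite_imageD by blast
  moreover have "f ` A \<subseteq> {t. primitively_nonspectral_eigenvalue b D C t}" using f(2) by auto
  ultimately show ?thesis by (rule infinite_super[rotated])
qed

end

theorem theorem1p6:
  fixes b :: int and D C :: "int set"
  assumes "canonical_hadamard_triple b D C"
  shows "infinite {t :: nat. primitively_nonspectral_eigenvalue b D C t}"
proof -
  interpret canonical_triple b D C by (rule canonical_triple.intro) (rule assms)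
  show ?thesis by (rule infinite_primitively_nonspectral)
qed

end
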